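(* Let $\mathbb{K}$ be any infinite field. There is no sentence $\psi_{\mathbb{K}}$ of the language $\mathit{MS}_0$ such that, for every (finite) matroid $M$, $M$ is $\mathbb{K}$-representable if and only if $M$ satisfies $\psi_{\mathbb{K}}$.
   Context: All matroids are finite. $\mathit{MS}_0$ is the following monadic second-order language for matroids. It has variables $X_1,X_2,X_3,\ldots$, atomic formulas $X_i\subseteq X_j$, $\mathrm{Sing}(X_i)$, $\mathrm{Ind}(X_i)$, the connectives $\neg,\land$ and the quantifiers $\exists,\forall$. Formulas $\psi$, with their variable sets $\mathrm{Var}(\psi)$ and free-variable sets $\mathrm{Fr}(\psi)$, are built recursively: an atomic formula has $\mathrm{Fr}=\mathrm{Var}=$ the set of variables occurring in it; $\neg\psi$ has the same $\mathrm{Var}$ and $\mathrm{Fr}$ as $\psi$; $\psi_1\land\psi_2$ is a formula provided $\mathrm{Fr}(\psi_i)\cap(\mathrm{Var}(\psi_j)-\mathrm{Fr}(\psi_j))=\emptyset$ for $\{i,j\}=\{1,2\}$, with $\mathrm{Var}$ and $\mathrm{Fr}$ the respective unions; if $X_i\in\mathrm{Fr}(\psi)$ then $\exists X_i\,\psi$ and $\forall X_i\,\psi$ are formulas with variable set $\mathrm{Var}(\psi)$ and free-variable set $\mathrm{Fr}(\psi)-\{X_i\}$. A sentence is a formula with no free variables. A matroid $M$ satisfies a sentence if the sentence is true when variables range over subsets of the ground set $E(M)$, $X_i\subseteq X_j$ means set containment, $\mathrm{Sing}(X_i)$ means $|X_i|=1$, and $\mathrm{Ind}(X_i)$ means $X_i$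 is independent in $M$. *)

theory Defs
  imports "Jordan_Normal_Form.VS_Connect"
begin

section \<open>Finite matroids\<close>

text \<open>
  Representability and satisfaction, defined below, are invariant under isomorphism, and every
  finite matroid is isomorphic to one whose ground set is a finite set of natural numbers, so
  matroids with \<open>E :: nat set\<close> suffice for statements about all finite matroids.
\<close>

locale matroid =
  fixes E :: "'e set" and indep :: "'e set \<Rightarrow> bool"
  assumes finite_ground: "finite E"
    and indep_ground: "indep X \<Longrightarrow> X \<subseteq> E"
    and indep_empty: "indep {}"
    and indep_subset: "indep Y \<Longrightarrow> X \<subseteq> Y \<Longrightarrow> indep X"
    and indep_augment: "indep X \<Longrightarrow> indep Y \<Longrightarrow> card X < card Y \<Longrightarrow>
      \<exists>y \<in> Y - X. indep (insert y X)"

text \<open>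
  Over the field \<open>'k\<close>, \<open>col\<close> lists the columns, labelled by \<open>E\<close>, of a matrix with \<open>r\<close> rows.
  Distinct elements may label equal columns, so independence of the labelled family
  \<open>(col e)\<close> with \<open>e \<in> X\<close> means that \<open>col\<close> is injective on \<open>X\<close> and that the set
  \<open>col ` X\<close> is linearly independent.
\<close>

definition representable :: "'k::field itself \<Rightarrow> 'e set \<Rightarrow> ('e set \<Rightarrow> bool) \<Rightarrow> bool" where
  "representable K E indep \<longleftrightarrow>
    (\<exists>(r :: nat) (col :: 'e \<Rightarrow> 'k vec). col \<in> E \<rightarrow> carrier_vec r \<and>
      (\<forall>X \<subseteq> E. indep X \<longleftrightarrow>
        inj_on col X \<and> \<not> module.lin_dep class_ring (module_vec K r) (col ` X)))"


section \<open>The language \<open>MS\<^sub>0\<close>\<close>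

datatype ms0 =
    Subset nat nat
  | Sing nat
  | Ind nat
  | Neg ms0
  | Conj ms0 ms0
  | Exists nat ms0
  | Forall nat ms0

fun Var :: "ms0 \<Rightarrow> nat set" where
  "Var (Subset i j) = {i, j}"
| "Var (Sing i) = {i}"
| "Var (Ind i) = {i}"
| "Var (Neg \<psi>) = Var \<psi>"
| "Var (Conj \<psi>\<^sub>1 \<psi>\<^sub>2) = Var \<psi>\<^sub>1 \<union> Var \<psi>\<^sub>2"
| "Var (Exists i \<psi>) = Var \<psi>"
| "Var (Forall i \<psi>) = Var \<psi>"

fun Fr :: "ms0 \<Rightarrow> nat set" where
  "Fr (Subset i j) = {i, j}"
| "Fr (Sing i) = {i}"
| "Fr (Ind i) = {i}"
| "Fr (Neg \<psi>) = Fr \<psi>"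
| "Fr (Conj \<psi>\<^sub>1 \<psi>\<^sub>2) = Fr \<psi>\<^sub>1 \<union> Fr \<psi>\<^sub>2"
| "Fr (Exists i \<psi>) = Fr \<psi> - {i}"
| "Fr (Forall i \<psi>) = Fr \<psi> - {i}"

text \<open>
  The datatype also contains expressions that violate the side conditions on conjunction and
  quantification; the formulas of \<open>MS\<^sub>0\<close> are those satisfying the following predicate.
\<close>

fun formula :: "ms0 \<Rightarrow> bool" where
  "formula (Subset i j) = True"
| "formula (Sing i) = True"
| "formula (Ind i) = True"
| "formula (Neg \<psi>) = formula \<psi>"
| "formula (Conj \<psi>\<^sub>1 \<psi>\<^sub>2) =
    (formula \<psi>\<^sub>1 \<and> formula \<psi>\<^sub>2 \<and>
     Fr \<psi>\<^sub>1 \<inter> (Var \<psi>\<^sub>2 - Fr \<psi>\<^sub>2) = {} \<and> Fr \<psi>\<^sub>2 \<inter> (Var \<psi>\<^sub>1 - Fr \<psi>\<^sub>1) = {})"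
| "formula (Exists i \<psi>) = (formula \<psi> \<and> i \<in> Fr \<psi>)"
| "formula (Forall i \<psi>) = (formula \<psi> \<and> i \<in> Fr \<psi>)"

definition sentence :: "ms0 \<Rightarrow> bool" where
  "sentence \<psi> \<longleftrightarrow> formula \<psi> \<and> Fr \<psi> = {}"

fun sat :: "'e set \<Rightarrow> ('e set \<Rightarrow> bool) \<Rightarrow> (nat \<Rightarrow> 'e set) \<Rightarrow> ms0 \<Rightarrow> bool" where
  "sat E indep \<sigma> (Subset i j) = (\<sigma> i \<subseteq> \<sigma> j)"
| "sat E indep \<sigma> (Sing i) = (card (\<sigma> i) = 1)"
| "sat E indep \<sigma> (Ind i) = indep (\<sigma> i)"
| "sat E indep \<sigma> (Neg \<psi>) = (\<not> sat E indep \<sigma> \<psi>)"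
| "sat E indep \<sigma> (Conj \<psi>\<^sub>1 \<psi>\<^sub>2) = (sat E indep \<sigma> \<psi>\<^sub>1 \<and> sat E indep \<sigma> \<psi>\<^sub>2)"
| "sat E indep \<sigma> (Exists i \<psi>) = (\<exists>X \<subseteq> E. sat E indep (\<sigma>(i := X)) \<psi>)"
| "sat E indep \<sigma> (Forall i \<psi>) = (\<forall>X \<subseteq> E. sat E indep (\<sigma>(i := X)) \<psi>)"

text \<open>The truth value of a sentence does not depend on the assignment.\<close>

definition satisfies :: "'e set \<Rightarrow> ('e set \<Rightarrow> bool) \<Rightarrow> ms0 \<Rightarrow> bool" where
  "satisfies E indep \<psi> \<longleftrightarrow> (\<forall>\<sigma>. (\<forall>i. \<sigma> i \<subseteq> E) \<longrightarrow> sat E indep \<sigma> \<psi>)"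

end

theory Submission
  imports Defs "HOL-Library.Countable"
begin

text \<open>
  A simple matroid of rank three whose points lie on the sides of a triangle encodes equations
  between gains in the multiplicative group of a field. The ladder matroid with rails of lengths
  \<open>n\<close> and \<open>m\<close> forces \<open>\<rho> ^ n = \<rho> ^ m\<close> for an element \<open>\<rho>\<close> whose powers up to the larger of \<open>n\<close> and
  \<open>m\<close> are distinct, so over an infinite field it is representable iff \<open>n = m\<close>. On the other hand, a
  set is split by the two rails into two parts, and its independence depends on the first part only
  through boundedly many properties. By induction on the formula, for a fixed sentence the truth
  value in the ladder with rails \<open>n\<close> and \<open>m\<close>, seen as a matrix indexed by \<open>n\<close> and \<open>m\<close>, has only
  finitely many distinct rows. So two rows \<open>n \<noteq> m\<close> agree, in particular in column \<open>n\<close>, and the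
  sentence does not distinguish the ladder \<open>(n, n)\<close> from the ladder \<open>(m, n)\<close>.
\<close>

section \<open>Invariance under isomorphism\<close>

lemma sat_cong:
  assumes "\<And>i. i \<in> Fr \<psi> \<Longrightarrow> \<sigma> i = \<tau> i"
  shows "sat E ind \<sigma> \<psi> \<longleftrightarrow> sat E ind \<tau> \<psi>"
  using assms
proof (induction \<psi> arbitrary: \<sigma> \<tau>)
  case (Conj \<psi>\<^sub>1 \<psi>\<^sub>2)
  then show ?case by (metis Fr.simps(5) UnCI sat.simps(5))
next
  case (Neg \<psi>)
  have "sat E ind \<sigma> \<psi> \<longleftrightarrow> sat E ind \<tau> \<psi>"
    by (rule Neg.IH) (use Neg.prems in simp)
  then show ?case by simp
next
  case (Exists i \<psi>)
  have "sat E ind (\<sigma>(i := X)) \<psi> \<longleftrightarrow> sat E ind (\<tau>(i := X)) \<psi>" for X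
    by (rule Exists.IH) (use Exists.prems in auto)
  then show ?case by simp
next
  case (Forall i \<psi>)
  have "sat E ind (\<sigma>(i := X)) \<psi> \<longleftrightarrow> sat E ind (\<tau>(i := X)) \<psi>" for X
    by (rule Forall.IH) (use Forall.prems in auto)
  then show ?case by simp
qed simp_all

lemma satisfies_sentence_iff:
  assumes "sentence \<psi>"
  shows "satisfies E ind \<psi> \<longleftrightarrow> sat E ind (\<lambda>_. {}) \<psi>"
proof -
  have "sat E ind \<sigma> \<psi> \<longleftrightarrow> sat E ind (\<lambda>_. {}) \<psi>" for \<sigma>
    using assms by (intro sat_cong) (simp add: sentence_def)
  moreover have "\<forall>i. (\<lambda>_. {}) i \<subseteq> E" by simp
  ultimately show ?thesis unfolding satisfies_def by blast
qed

text \<open>The theorem quantifies over matroids on sets of naturals, while the ladders live on a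
  datatype. This is the structure transported along an injection \<open>h\<close>, in the end
  \<open>to_nat\<close>.\<close>

definition image_indep :: "('a \<Rightarrow> 'b) \<Rightarrow> ('a set \<Rightarrow> bool) \<Rightarrow> 'b set \<Rightarrow> bool" where
  "image_indep h ind X \<longleftrightarrow> (\<exists>Y. X = h ` Y \<and> ind Y)"

lemma image_indep_image [simp]: "inj h \<Longrightarrow> image_indep h ind (h ` X) \<longleftrightarrow> ind X"
  by (auto simp: image_indep_def inj_image_eq_iff)

lemma matroid_image:
  assumes "inj h" "matroid E ind"
  shows "matroid (h ` E) (image_indep h ind)"
proof -
  interpret matroid E ind by fact
  have card: "card (h ` X) = card X" for X
    using assms(1) by (meson card_image inj_on_subset subset_UNIV)
  show ?thesis
  proof
    show "finite (h ` E)" using finite_ground by simp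
    show "X \<subseteq> h ` E" if "image_indep h ind X" for X
      using that indep_ground unfolding image_indep_def by blast
    show "image_indep h ind {}"
      using indep_empty unfolding image_indep_def by blast
    show "image_indep h ind X" if "image_indep h ind Y" "X \<subseteq> Y" for X Y
      using that indep_subset unfolding image_indep_def by (metis subset_image_iff)
    fix X Y assume "image_indep h ind X" "image_indep h ind Y" "card X < card Y"
    then obtain X' Y' where XY: "X = h ` X'" "Y = h ` Y'" "ind X'" "ind Y'" "card X' < card Y'"
      unfolding image_indep_def by (auto simp: card)
    then obtain y where y: "y \<in> Y' - X'" "ind (insert y X')" using indep_augment by blast
    then have "h y \<in> Y - X" "image_indep h ind (insert (h y) X)"
      using XY assms(1) image_indep_image[OF assms(1), of ind "insert y X'"] by (auto simp: inj_image_mem_iff)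
    then show "\<exists>y\<in>Y - X. image_indep h ind (insert y X)" by blast
  qed
qed

lemma sat_image:
  assumes "inj h"
  shows "sat (h ` E) (image_indep h ind) (\<lambda>i. h ` \<sigma> i) \<psi> \<longleftrightarrow> sat E ind \<sigma> \<psi>"
proof (induction \<psi> arbitrary: \<sigma>)
  case (Subset i j)
  then show ?case using assms by (simp add: inj_image_subset_iff)
next
  case (Sing i)
  then show ?case using assms card_image inj_on_subset by (metis sat.simps(2) subset_UNIV)
next
  case (Exists i \<psi>)
  have "(\<lambda>j. h ` \<sigma> j)(i := h ` X) = (\<lambda>j. h ` (\<sigma>(i := X)) j)" for X
    by (rule ext) simp
  moreover have "(\<exists>X\<subseteq>h ` E. P X) \<longleftrightarrow> (\<exists>X\<subseteq>E. P (h ` X))" for P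
    by (metis image_mono subset_imageE)
  ultimately show ?case using Exists.IH by (simp del: fun_upd_apply)
next
  case (Forall i \<psi>)
  have "(\<lambda>j. h ` \<sigma> j)(i := h ` X) = (\<lambda>j. h ` (\<sigma>(i := X)) j)" for X
    by (rule ext) simp
  moreover have "(\<forall>X\<subseteq>h ` E. P X) \<longleftrightarrow> (\<forall>X\<subseteq>E. P (h ` X))" for P
    by (metis image_mono subset_imageE)
  ultimately show ?case using Forall.IH by (simp del: fun_upd_apply)
qed (simp_all add: assms)

lemma satisfies_image:
  assumes "inj h" "sentence \<psi>"
  shows "satisfies (h ` E) (image_indep h ind) \<psi> \<longleftrightarrow> satisfies E ind \<psi>"
  using sat_image[OF assms(1), of E ind "\<lambda>_. {}"] assms(2)
  by (simp add: satisfies_sentence_iff)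

lemma representable_image:
  assumes "inj h"
  shows "representable K (h ` E) (image_indep h ind) \<longleftrightarrow> representable K E ind"
proof
  assume "representable K (h ` E) (image_indep h ind)"
  then obtain r col where col: "col \<in> h ` E \<rightarrow> carrier_vec r"
    "\<And>X. X \<subseteq> h ` E \<Longrightarrow> image_indep h ind X \<longleftrightarrow>
        inj_on col X \<and> \<not> module.lin_dep class_ring (module_vec K r) (col ` X)"
    unfolding representable_def by blast
  have "ind X \<longleftrightarrow> inj_on (col \<circ> h) X \<and>
      \<not> module.lin_dep class_ring (module_vec K r) ((col \<circ> h) ` X)" if "X \<subseteq> E" for X
  proof -
    have "inj_on (col \<circ> h) X \<longleftrightarrow> inj_on col (h ` X)"
      using comp_inj_on_iff inj_on_subset[OF assms subset_UNIV] by blast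
    then show ?thesis
      using col(2)[OF image_mono[OF that, of h]] assms by (simp add: image_image)
  qed
  then show "representable K E ind"
    unfolding representable_def using col(1) by (intro exI[of _ r] exI[of _ "col \<circ> h"]) auto
next
  assume "representable K E ind"
  then obtain r col where col: "col \<in> E \<rightarrow> carrier_vec r"
    "\<And>X. X \<subseteq> E \<Longrightarrow> ind X \<longleftrightarrow>
        inj_on col X \<and> \<not> module.lin_dep class_ring (module_vec K r) (col ` X)"
    unfolding representable_def by blast
  define c where "c = col \<circ> the_inv h"
  have c: "c (h x) = col x" for x using assms by (simp add: c_def the_inv_f_f)
  have "image_indep h ind X \<longleftrightarrow> inj_on c X \<and>
      \<not> module.lin_dep class_ring (module_vec K r) (c ` X)" if "X \<subseteq> h ` E" for X
  proof -
    obtain Y where Y: "X = h ` Y" "Y \<subseteq> E" using \<open>X \<subseteq> h ` E\<close> by (meson subset_image_iff)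
    have "c \<circ> h = col" by (rule ext) (simp add: c)
    then have "inj_on c X \<longleftrightarrow> inj_on col Y" "c ` X = col ` Y"
      using Y comp_inj_on_iff[of h Y c] inj_on_subset[OF assms subset_UNIV] by (auto simp: c image_image)
    then show ?thesis using col(2)[of Y] Y assms by simp
  qed
  then show "representable K (h ` E) (image_indep h ind)"
    unfolding representable_def using col(1) by (intro exI[of _ r] exI[of _ c]) (auto simp: c)
qed

section \<open>Composition of structures\<close>

text \<open>
  Read \<open>f\<close> as a 0-1 matrix with rows indexed by \<open>A\<close> and columns indexed by \<open>B\<close>.
\<close>

definition finite_rows :: "'a set \<Rightarrow> 'b set \<Rightarrow> ('a \<Rightarrow> 'b \<Rightarrow> bool) \<Rightarrow> bool" where
  "finite_rows A B f \<longleftrightarrow> finite ((\<lambda>a. {b \<in> B. f a b}) ` A)"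

lemma finite_rows_cong:
  assumes "\<And>a b. a \<in> A \<Longrightarrow> b \<in> B \<Longrightarrow> f a b \<longleftrightarrow> g a b"
  shows "finite_rows A B f \<longleftrightarrow> finite_rows A B g"
proof -
  have "(\<lambda>a. {b \<in> B. f a b}) ` A = (\<lambda>a. {b \<in> B. g a b}) ` A"
    by (rule image_cong) (use assms in auto)
  then show ?thesis by (simp add: finite_rows_def)
qed

lemma finite_rows_left: "finite_rows A B (\<lambda>a _. P a)"
proof -
  have "(\<lambda>a. {b \<in> B. P a}) ` A \<subseteq> {B, {}}" by auto
  then show ?thesis unfolding finite_rows_def using finite_subset by blast
qed

lemma finite_rows_right: "finite_rows A B (\<lambda>_ b. Q b)"
proof -
  have "(\<lambda>_. {b \<in> B. Q b}) ` A \<subseteq> {{b \<in> B. Q b}}" by auto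
  then show ?thesis unfolding finite_rows_def using finite_subset by blast
qed

lemma finite_rows_Not:
  assumes "finite_rows A B f"
  shows "finite_rows A B (\<lambda>a b. \<not> f a b)"
proof -
  have "{b \<in> B. \<not> f a b} = B - {b \<in> B. f a b}" for a by auto
  then have "(\<lambda>a. {b \<in> B. \<not> f a b}) ` A = (\<lambda>R. B - R) ` (\<lambda>a. {b \<in> B. f a b}) ` A"
    by (simp add: image_image)
  then show ?thesis using assms unfolding finite_rows_def by simp
qed

lemma finite_rows_conj:
  assumes "finite_rows A B f" "finite_rows A B g"
  shows "finite_rows A B (\<lambda>a b. f a b \<and> g a b)"
proof -
  have "{b \<in> B. f a b \<and> g a b} = {b \<in> B. f a b} \<inter> {b \<in> B. g a b}" for a by auto
  then have "(\<lambda>a. {b \<in> B. f a b \<and> g a b}) ` A \<subseteq>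
      (\<lambda>(R, S). R \<inter> S) ` ((\<lambda>a. {b \<in> B. f a b}) ` A \<times> (\<lambda>a. {b \<in> B. g a b}) ` A)"
    by auto
  then show ?thesis
    using assms unfolding finite_rows_def by (meson finite_SigmaI finite_imageI finite_subset)
qed

lemma finite_rows_disj:
  assumes "finite_rows A B f" "finite_rows A B g"
  shows "finite_rows A B (\<lambda>a b. f a b \<or> g a b)"
  using finite_rows_Not[OF finite_rows_conj[OF assms[THEN finite_rows_Not]]] by (simp only: de_Morgan_conj not_not)

lemma finite_rows_Bex:
  assumes "finite I" "\<And>i. i \<in> I \<Longrightarrow> finite_rows A B (f i)"
  shows "finite_rows A B (\<lambda>a b. \<exists>i\<in>I. f i a b)"
  using assms
  by (induction I rule: finite_induct) (auto intro: finite_rows_left finite_rows_disj)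

text \<open>The row of \<open>a\<close> in the quantified matrix depends only on the set of rows of
  \<open>f\<close> with index in \<open>S a\<close>; the map \<open>?h\<close> recovers it from that
  set. Finitely many rows form only finitely many sets.\<close>

lemma finite_rows_exists:
  assumes "finite_rows A B f"
    and S: "\<And>a. a \<in> A \<Longrightarrow> S a \<subseteq> A" and T: "\<And>b. b \<in> B \<Longrightarrow> T b \<subseteq> B"
  shows "finite_rows A B (\<lambda>a b. \<exists>a'\<in>S a. \<exists>b'\<in>T b. f a' b')"
proof -
  let ?row = "\<lambda>a. {b \<in> B. f a b}"
  let ?h = "\<lambda>\<R>. {b \<in> B. \<exists>R\<in>\<R>. \<exists>b'\<in>T b. b' \<in> R}"
  have "{b \<in> B. \<exists>a'\<in>S a. \<exists>b'\<in>T b. f a' b'} \<in> ?h ` Pow (?row ` A)" if "a \<in> A" for a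
  proof -
    have "{b \<in> B. \<exists>a'\<in>S a. \<exists>b'\<in>T b. f a' b'} = ?h (?row ` S a)"
      using T by fastforce
    moreover have "?row ` S a \<in> Pow (?row ` A)" using S[OF that] by blast
    ultimately show ?thesis by (rule image_eqI)
  qed
  then have "(\<lambda>a. {b \<in> B. \<exists>a'\<in>S a. \<exists>b'\<in>T b. f a' b'}) ` A \<subseteq> ?h ` Pow (?row ` A)"
    by (rule image_subsetI)
  then show ?thesis
    using assms(1) unfolding finite_rows_def by (meson finite_Pow_iff finite_imageI finite_subset)
qed

text \<open>There are only \<open>k + 1\<close> ways to split \<open>k\<close> into two summands,
  and each is a condition on the row together with a condition on the column.\<close>

lemma finite_rows_card_eq:
  assumes "\<And>a b. a \<in> A \<Longrightarrow> b \<in> B \<Longrightarrow> s a b = (p a :: nat) + q b"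
  shows "finite_rows A B (\<lambda>a b. s a b = k)"
proof -
  have "finite_rows A B (\<lambda>a b. \<exists>i\<in>{..k}. p a = i \<and> q b = k - i)"
    by (intro finite_rows_Bex finite_rows_conj finite_rows_left finite_rows_right) simp
  moreover have "s a b = k \<longleftrightarrow> (\<exists>i\<in>{..k}. p a = i \<and> q b = k - i)" if "a \<in> A" "b \<in> B" for a b
    using assms[OF that] by auto
  ultimately show ?thesis by (simp cong: finite_rows_cong)
qed

text \<open>Each index carries its own assignment, and \<open>I\<close> may be infinite. So a finite
  number of rows is a bound that is uniform over all structures, not one for each structure.\<close>

definition assignments :: "'i set \<Rightarrow> ('i \<Rightarrow> 'e set) \<Rightarrow> ('i \<times> (nat \<Rightarrow> 'e set)) set" where
  "assignments I F = {a. fst a \<in> I \<and> (\<forall>i. snd a i \<subseteq> F (fst a))}"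

text \<open>A subset of the union is the union of its traces on the two parts. Hence one set
  quantifier amounts to two independent moves, one of the row index and one of the column
  index.\<close>

lemma finite_rows_sat_Exists:
  fixes F :: "'i \<Rightarrow> 'e set" and G :: "'j \<Rightarrow> 'e set"
  assumes "finite_rows (assignments I F) (assignments J G)
    (\<lambda>a b. sat (F (fst a) \<union> G (fst b)) (ind (fst a) (fst b)) (\<lambda>i. snd a i \<union> snd b i) \<psi>)"
  shows "finite_rows (assignments I F) (assignments J G)
    (\<lambda>a b. sat (F (fst a) \<union> G (fst b)) (ind (fst a) (fst b)) (\<lambda>i. snd a i \<union> snd b i) (Exists i \<psi>))"
proof -
  let ?f = "\<lambda>a b. sat (F (fst a) \<union> G (fst b)) (ind (fst a) (fst b)) (\<lambda>i. snd a i \<union> snd b i) \<psi>"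
  define S :: "'i \<times> (nat \<Rightarrow> 'e set) \<Rightarrow> ('i \<times> (nat \<Rightarrow> 'e set)) set"
    where "S a = (\<lambda>X. (fst a, (snd a)(i := X))) ` Pow (F (fst a))" for a
  define T :: "'j \<times> (nat \<Rightarrow> 'e set) \<Rightarrow> ('j \<times> (nat \<Rightarrow> 'e set)) set"
    where "T b = (\<lambda>X. (fst b, (snd b)(i := X))) ` Pow (G (fst b))" for b
  have "(\<exists>a'\<in>S a. \<exists>b'\<in>T b. ?f a' b') \<longleftrightarrow>
      sat (F (fst a) \<union> G (fst b)) (ind (fst a) (fst b)) (\<lambda>i. snd a i \<union> snd b i) (Exists i \<psi>)" for a b
  proof -
    have upd: "(\<lambda>j. ((snd a)(i := X)) j \<union> ((snd b)(i := Y)) j) = (\<lambda>j. snd a j \<union> snd b j)(i := X \<union> Y)"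
      for X Y
      by (rule ext) simp
    have "(\<exists>X\<subseteq>F (fst a). \<exists>Y\<subseteq>G (fst b). P (X \<union> Y)) \<longleftrightarrow> (\<exists>Z\<subseteq>F (fst a) \<union> G (fst b). P Z)" for P
    proof
      assume "\<exists>Z\<subseteq>F (fst a) \<union> G (fst b). P Z"
      then obtain Z where "Z \<subseteq> F (fst a) \<union> G (fst b)" "P Z" by blast
      then have "P ((Z \<inter> F (fst a)) \<union> (Z \<inter> G (fst b)))"
        by (simp add: Int_absorb2 flip: Int_Un_distrib)
      then show "\<exists>X\<subseteq>F (fst a). \<exists>Y\<subseteq>G (fst b). P (X \<union> Y)" by (meson Int_lower2)
    next
      assume "\<exists>X\<subseteq>F (fst a). \<exists>Y\<subseteq>G (fst b). P (X \<union> Y)"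
      then show "\<exists>Z\<subseteq>F (fst a) \<union> G (fst b). P Z" by (meson Un_mono)
    qed
    then show ?thesis by (simp add: S_def T_def upd Bex_def del: fun_upd_apply)
  qed
  moreover have "S a \<subseteq> assignments I F" if "a \<in> assignments I F" for a
    using that by (simp add: S_def assignments_def image_subset_iff)
  moreover have "T b \<subseteq> assignments J G" if "b \<in> assignments J G" for b
    using that by (simp add: T_def assignments_def image_subset_iff)
  ultimately show ?thesis
    using finite_rows_exists[OF assms, of S T] by presburger
qed

text \<open>
  A composition theorem in the style of Feferman and Vaught; the assignment of \<open>\<psi>\<close> is split
  between the row and the column indices.
\<close>

lemma finite_rows_sat:
  fixes F :: "'i \<Rightarrow> 'e set" and G :: "'j \<Rightarrow> 'e set"
  assumes fin: "\<And>n. n \<in> I \<Longrightarrow> finite (F n)" "\<And>m. m \<in> J \<Longrightarrow> finite (G m)"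
    and disj: "\<And>n m. n \<in> I \<Longrightarrow> m \<in> J \<Longrightarrow> F n \<inter> G m = {}"
    and ind: "finite_rows (SIGMA n:I. Pow (F n)) (SIGMA m:J. Pow (G m))
      (\<lambda>a b. ind (fst a) (fst b) (snd a \<union> snd b))"
  shows "finite_rows (assignments I F) (assignments J G)
    (\<lambda>a b. sat (F (fst a) \<union> G (fst b)) (ind (fst a) (fst b)) (\<lambda>i. snd a i \<union> snd b i) \<psi>)"
proof (induction \<psi>)
  case (Subset i j)
  have "finite_rows (assignments I F) (assignments J G)
      (\<lambda>a b. (snd a i \<subseteq> snd a j) \<and> (snd b i \<subseteq> snd b j))"
    by (intro finite_rows_conj finite_rows_left finite_rows_right)
  also have "?this \<longleftrightarrow> finite_rows (assignments I F) (assignments J G)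
      (\<lambda>a b. snd a i \<union> snd b i \<subseteq> snd a j \<union> snd b j)"
  \<comment> \<open>By disjointness, no element of one part can be covered by a set living in the
    other part.\<close>
  proof (rule finite_rows_cong)
    fix a b assume "a \<in> assignments I F" "b \<in> assignments J G"
    then have ab: "snd a k \<subseteq> F (fst a)" "snd b k \<subseteq> G (fst b)" "F (fst a) \<inter> G (fst b) = {}" for k
      using disj by (simp_all add: assignments_def)
    have "snd a k \<inter> snd b l = {}" for k l using ab(1)[of k] ab(2)[of l] ab(3) by blast
    from this[of i j] this[of j i]
    show "snd a i \<subseteq> snd a j \<and> snd b i \<subseteq> snd b j \<longleftrightarrow> snd a i \<union> snd b i \<subseteq> snd a j \<union> snd b j"
      by blast
  qed
  finally show ?case by simp
next
  case (Sing i)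
  have "card (snd a i \<union> snd b i) = card (snd a i) + card (snd b i)"
    if "a \<in> assignments I F" "b \<in> assignments J G" for a b
  proof -
    have ab: "fst a \<in> I" "snd a i \<subseteq> F (fst a)" "fst b \<in> J" "snd b i \<subseteq> G (fst b)"
      using that by (simp_all add: assignments_def)
    have "finite (snd a i)" "finite (snd b i)"
      using ab fin finite_subset by blast+
    moreover have "snd a i \<inter> snd b i = {}"
      using ab disj[of "fst a" "fst b"] by blast
    ultimately show ?thesis by (rule card_Un_disjoint)
  qed
  then have "finite_rows (assignments I F) (assignments J G)
      (\<lambda>a b. card (snd a i \<union> snd b i) = 1)"
    by (rule finite_rows_card_eq)
  then show ?case by simp
next
  case (Ind i)
  \<comment> \<open>A row for this atom is the preimage of a row of the matrix in assumption
    \<open>ind\<close>, under evaluating the column assignment at \<open>i\<close>.\<close>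
  let ?r = "\<lambda>a. {b \<in> SIGMA m:J. Pow (G m). ind (fst a) (fst b) (snd a \<union> snd b)}"
  let ?h = "\<lambda>R. {b \<in> assignments J G. (fst b, snd b i) \<in> R}"
  have "{b \<in> assignments J G. ind (fst a) (fst b) (snd a i \<union> snd b i)}
      \<in> ?h ` ?r ` (SIGMA n:I. Pow (F n))" if "a \<in> assignments I F" for a
  proof -
    have "{b \<in> assignments J G. ind (fst a) (fst b) (snd a i \<union> snd b i)} = ?h (?r (fst a, snd a i))"
      by (auto simp: assignments_def)
    moreover have "(fst a, snd a i) \<in> (SIGMA n:I. Pow (F n))"
      using that by (simp add: assignments_def)
    ultimately show ?thesis by (rule image_eqI[OF _ imageI])
  qed
  then have "(\<lambda>a. {b \<in> assignments J G. ind (fst a) (fst b) (snd a i \<union> snd b i)}) ` assignments I F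
     \<subseteq> ?h ` ?r ` (SIGMA n:I. Pow (F n))"
    by (rule image_subsetI)
  then show ?case
    using ind unfolding finite_rows_def sat.simps by (meson finite_imageI finite_subset)
next
  case (Neg \<psi>)
  from finite_rows_Not[OF this] show ?case by simp
next
  case (Conj \<psi>\<^sub>1 \<psi>\<^sub>2)
  from finite_rows_conj[OF this] show ?case by simp
next
  case (Exists i \<psi>)
  then show ?case by (rule finite_rows_sat_Exists)
next
  case (Forall i \<psi>)
  have "finite_rows (assignments I F) (assignments J G)
      (\<lambda>a b. sat (F (fst a) \<union> G (fst b)) (ind (fst a) (fst b)) (\<lambda>i. snd a i \<union> snd b i) (Neg \<psi>))"
    using finite_rows_Not[OF Forall.IH] by simp
  from finite_rows_Not[OF finite_rows_sat_Exists[OF this]]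
  show ?case by simp
qed

section \<open>Matroids of rank three given by their lines\<close>

text \<open>All sets of at most two points are independent, so the matroid is simple. Only lines
  with three or more points have to be listed in \<open>\<L>\<close>.\<close>

definition line_indep :: "'e set \<Rightarrow> 'e set set \<Rightarrow> 'e set \<Rightarrow> bool" where
  "line_indep E \<L> X \<longleftrightarrow> X \<subseteq> E \<and> card X \<le> 3 \<and> (card X = 3 \<longrightarrow> (\<forall>l\<in>\<L>. \<not> X \<subseteq> l))"

text \<open>Augmentation is delicate only from two points \<open>a\<close>, \<open>b\<close> to a
  triple \<open>Y\<close>. If it failed, every point of \<open>Y\<close> outside
  \<open>{a, b}\<close> would span with them a line of \<open>\<L>\<close>; these lines share
  \<open>a\<close> and \<open>b\<close>, so they are one line, which contains
  \<open>Y\<close>.\<close>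

lemma matroid_line_indep:
  assumes E: "finite E"
    and line_unique: "\<And>k l a b. k \<in> \<L> \<Longrightarrow> l \<in> \<L> \<Longrightarrow> a \<noteq> b \<Longrightarrow> {a, b} \<subseteq> k \<Longrightarrow> {a, b} \<subseteq> l \<Longrightarrow> k = l"
  shows "matroid E (line_indep E \<L>)"
proof
  show "finite E" by fact
  show "X \<subseteq> E" if "line_indep E \<L> X" for X using that by (simp add: line_indep_def)
  show "line_indep E \<L> {}" by (simp add: line_indep_def)
  show "line_indep E \<L> X" if Y: "line_indep E \<L> Y" and XY: "X \<subseteq> Y" for X Y
  proof -
    have fin: "finite Y" using Y E finite_subset by (auto simp: line_indep_def)
    have "X = Y" if "card X = 3"
      using card_seteq[OF fin XY] Y that by (simp add: line_indep_def)
    then show ?thesis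
      using Y XY card_mono[OF fin XY] by (auto simp: line_indep_def)
  qed
  fix X Y assume X: "line_indep E \<L> X" and Y: "line_indep E \<L> Y" and less: "card X < card Y"
  have fin: "finite X" "finite Y" using X Y E finite_subset by (auto simp: line_indep_def)
  obtain z where z: "z \<in> Y - X" using less fin by (metis Diff_iff card_mono linorder_not_less subsetI)
  show "\<exists>y\<in>Y - X. line_indep E \<L> (insert y X)"
  proof (cases "card X = 2")
    case False
    then have "card (insert z X) \<le> 2"
      using less Y z fin by (simp add: line_indep_def)
    then have "line_indep E \<L> (insert z X)"
      using X Y z by (auto simp: line_indep_def)
    then show ?thesis using z by blast
  next
    case True
    then have "card Y = 3" using less Y by (simp add: line_indep_def)
    from True obtain a b where ab: "X = {a, b}" "a \<noteq> b" by (meson card_2_iff)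
    show ?thesis
    proof (rule ccontr)
      assume dep: "\<not> ?thesis"
      have "\<exists>l\<in>\<L>. insert y X \<subseteq> l" if "y \<in> Y - X" for y
      proof -
        have "insert y X \<subseteq> E" "card (insert y X) = 3"
          using X Y that fin True by (auto simp: line_indep_def)
        then show ?thesis using dep that by (auto simp: line_indep_def)
      qed
      then obtain l where l: "\<And>y. y \<in> Y - X \<Longrightarrow> l y \<in> \<L> \<and> insert y X \<subseteq> l y" by metis
      have "l y = l z" if "y \<in> Y - X" for y
        using line_unique[of "l y" "l z" a b] l[OF that] l[OF z] ab by auto
      then have "Y \<subseteq> l z" using l z by blast
      then show False using Y l[OF z] \<open>card Y = 3\<close> by (auto simp: line_indep_def)
    qed
  qed
qed

section \<open>Linear independence of labelled families, in coordinates\<close>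

definition indep_family :: "nat \<Rightarrow> ('e \<Rightarrow> nat \<Rightarrow> 'k::field) \<Rightarrow> 'e set \<Rightarrow> bool" where
  "indep_family r p X \<longleftrightarrow>
    (\<forall>c. (\<forall>j<r. (\<Sum>e\<in>X. c e * p e j) = 0) \<longrightarrow> (\<forall>e\<in>X. c e = 0))"

text \<open>In terms of families the injectivity clause disappears: two labels of the same column
  already give a nontrivial relation, with coefficients 1 and -1.\<close>

lemma indep_family_vec_iff:
  fixes col :: "'e \<Rightarrow> 'k::field vec"
  assumes X: "finite X" and col: "col \<in> X \<rightarrow> carrier_vec r"
  shows "inj_on col X \<and> \<not> module.lin_dep class_ring (module_vec TYPE('k) r) (col ` X) \<longleftrightarrow>
    indep_family r (\<lambda>e. vec_index (col e)) X"
    (is "?L \<longleftrightarrow> _")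
proof -
  let ?R = "\<forall>c. (\<forall>j<r. (\<Sum>e\<in>X. c e * col e $ j) = 0) \<longrightarrow> (\<forall>e\<in>X. c e = 0)"
  interpret vec_space "TYPE('k)" r .
  have sub: "col ` X \<subseteq> carrier_vec r" using col by auto
  have lc: "lincomb a (col ` X) = 0\<^sub>v r \<longleftrightarrow> (\<forall>j<r. (\<Sum>e\<in>X. a (col e) * col e $ j) = 0)"
    if "inj_on col X" for a
  proof -
    have "dim_vec (lincomb a (col ` X)) = r"
      by (rule lincomb_dim) (use X sub in auto)
    then have "lincomb a (col ` X) = 0\<^sub>v r \<longleftrightarrow> (\<forall>j<r. lincomb a (col ` X) $ j = 0)"
      by (auto simp: vec_eq_iff)
    then show ?thesis
      using that by (simp add: lincomb_index[OF _ sub] sum.reindex)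
  qed
  have "?L \<longleftrightarrow> ?R"
  proof
    assume L: ?L
    then have inj: "inj_on col X" and li: "lin_indpt (col ` X)" by auto
    show ?R
    proof (intro allI impI ballI)
      fix c e assume c: "\<forall>j<r. (\<Sum>e\<in>X. c e * col e $ j) = 0" and "e \<in> X"
      \<comment> \<open>Coefficients on labels become coefficients on vectors, which is well defined
        because \<open>col\<close> is injective.\<close>
      define a where "a = c \<circ> the_inv_into X col"
      have a: "a (col e) = c e" if "e \<in> X" for e
        using that inj by (simp add: a_def the_inv_into_f_f)
      have "lincomb a (col ` X) = 0\<^sub>v r" using c inj by (simp add: lc a)
      then have "a (col e) = 0"
        using li \<open>e \<in> X\<close> X sub not_lindepD[OF li, of "col ` X" a] by auto
      then show "c e = 0" using a \<open>e \<in> X\<close> by simp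
    qed
  next
    assume R: ?R
    have inj: "inj_on col X"
    proof (rule inj_onI, rule ccontr)
      fix e f assume ef: "e \<in> X" "f \<in> X" "col e = col f" "e \<noteq> f"
      define c :: "'e \<Rightarrow> 'k" where "c = (\<lambda>_. 0)(e := 1, f := -1)"
      have "(\<Sum>x\<in>X. c x * col x $ j) = 0" for j
      proof -
        have "(\<Sum>x\<in>X. c x * col x $ j) = (\<Sum>x\<in>{e, f}. c x * col x $ j)"
          using ef X by (intro sum.mono_neutral_right) (auto simp: c_def)
        then show ?thesis using ef by (simp add: c_def)
      qed
      then have "c e = 0" using R ef by blast
      then show False using ef by (simp add: c_def)
    qed
    have "\<forall>v\<in>col ` X. a v = 0" if "lincomb a (col ` X) = 0\<^sub>v r" for a
    proof -
      have "\<forall>j<r. (\<Sum>e\<in>X. a (col e) * col e $ j) = 0" using that lc[OF inj, of a] by blast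
      then have "\<forall>e\<in>X. a (col e) = 0" using R[THEN spec, of "\<lambda>e. a (col e)"] by blast
      then show ?thesis by blast
    qed
    then have "lin_indpt (col ` X)"
      by (intro finite_lin_indpt2) (use X sub in auto)
    then show ?L using inj by blast
  qed
  then show ?thesis by (simp add: indep_family_def)
qed

lemma representable_iff_indep_family:
  assumes "finite E"
  shows "representable TYPE('k::field) E ind \<longleftrightarrow>
    (\<exists>r p. \<forall>X\<subseteq>E. ind X \<longleftrightarrow> indep_family r (p :: 'e \<Rightarrow> nat \<Rightarrow> 'k) X)"
proof
  assume "representable TYPE('k) E ind"
  then obtain r and col :: "'e \<Rightarrow> 'k vec" where col: "col \<in> E \<rightarrow> carrier_vec r" and
    ind: "\<And>X. X \<subseteq> E \<Longrightarrow> ind X \<longleftrightarrow>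
      inj_on col X \<and> \<not> module.lin_dep class_ring (module_vec TYPE('k) r) (col ` X)"
    unfolding representable_def by blast
  have "ind X \<longleftrightarrow> indep_family r (\<lambda>e. vec_index (col e)) X" if "X \<subseteq> E" for X
    using ind[OF that] indep_family_vec_iff[of X col r] that col assms finite_subset by blast
  then show "\<exists>r p. \<forall>X\<subseteq>E. ind X \<longleftrightarrow> indep_family r (p :: 'e \<Rightarrow> nat \<Rightarrow> 'k) X" by blast
next
  assume "\<exists>r p. \<forall>X\<subseteq>E. ind X \<longleftrightarrow> indep_family r (p :: 'e \<Rightarrow> nat \<Rightarrow> 'k) X"
  then obtain r and p :: "'e \<Rightarrow> nat \<Rightarrow> 'k"
    where p: "\<And>X. X \<subseteq> E \<Longrightarrow> ind X \<longleftrightarrow> indep_family r p X" by blast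
  define col where "col e = vec r (p e)" for e
  have "ind X \<longleftrightarrow> inj_on col X \<and> \<not> module.lin_dep class_ring (module_vec TYPE('k) r) (col ` X)"
    if "X \<subseteq> E" for X
  proof -
    have "indep_family r (\<lambda>e. vec_index (col e)) X \<longleftrightarrow> indep_family r p X"
      by (simp add: indep_family_def col_def)
    moreover have "finite X" using assms that finite_subset by blast
    ultimately show ?thesis
      using p[OF that] indep_family_vec_iff[of X col r] by (simp add: col_def)
  qed
  then show "representable TYPE('k) E ind"
    unfolding representable_def by (intro exI[of _ r] exI[of _ col]) (auto simp: col_def)
qed

lemma indep_family_subset:
  assumes "indep_family r p Y" "X \<subseteq> Y" "finite Y"
  shows "indep_family r p X"
  unfolding indep_family_def
proof (intro allI impI ballI)
  fix c e assume c: "\<forall>j<r. (\<Sum>e\<in>X. c e * p e j) = 0" and "e \<in> X"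
  let ?d = "\<lambda>e. if e \<in> X then c e else 0"
  have "(\<Sum>e\<in>Y. ?d e * p e j) = (\<Sum>e\<in>X. c e * p e j)" for j
    using assms(2,3) by (intro sum.mono_neutral_cong_right) auto
  then have "\<forall>j<r. (\<Sum>e\<in>Y. ?d e * p e j) = 0" using c by simp
  then have "\<forall>e\<in>Y. ?d e = 0"
    using assms(1)[unfolded indep_family_def, THEN spec, of ?d] by blast
  then show "c e = 0" using \<open>e \<in> X\<close> \<open>X \<subseteq> Y\<close> by (metis subsetD)
qed

lemma indep_family_pair:
  assumes "a \<noteq> b"
  shows "indep_family r p {a, b} \<longleftrightarrow>
    (\<forall>x y. (\<forall>j<r. x * p a j + y * p b j = 0) \<longrightarrow> x = 0 \<and> y = 0)" (is "_ \<longleftrightarrow> ?R")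
proof
  assume L: "indep_family r p {a, b}"
  show ?R
  proof (intro allI impI)
    fix x y assume "\<forall>j<r. x * p a j + y * p b j = 0"
    then show "x = 0 \<and> y = 0"
      using L[unfolded indep_family_def, THEN spec, of "(\<lambda>_. 0)(a := x, b := y)"] assms
      by simp
  qed
next
  assume R: ?R
  show "indep_family r p {a, b}"
    unfolding indep_family_def
  proof (intro allI impI)
    fix c :: "'a \<Rightarrow> 'b" assume "\<forall>j<r. (\<Sum>e\<in>{a, b}. c e * p e j) = 0"
    then have "\<forall>j<r. c a * p a j + c b * p b j = 0" using assms by simp
    then have "c a = 0 \<and> c b = 0" using R by blast
    then show "\<forall>e\<in>{a, b}. c e = 0" by simp
  qed
qed

lemma indep_family_triple:
  assumes "a \<noteq> b" "a \<noteq> c" "b \<noteq> c"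
  shows "indep_family r p {a, b, c} \<longleftrightarrow>
    (\<forall>x y z. (\<forall>j<r. x * p a j + y * p b j + z * p c j = 0) \<longrightarrow> x = 0 \<and> y = 0 \<and> z = 0)"
    (is "_ \<longleftrightarrow> ?R")
proof
  assume L: "indep_family r p {a, b, c}"
  show ?R
  proof (intro allI impI)
    fix x y z assume "\<forall>j<r. x * p a j + y * p b j + z * p c j = 0"
    then show "x = 0 \<and> y = 0 \<and> z = 0"
      using L[unfolded indep_family_def, THEN spec, of "(\<lambda>_. 0)(a := x, b := y, c := z)"] assms
      by (simp add: add.assoc)
  qed
next
  assume R: ?R
  show "indep_family r p {a, b, c}"
    unfolding indep_family_def
  proof (intro allI impI)
    fix d :: "'a \<Rightarrow> 'b" assume "\<forall>j<r. (\<Sum>e\<in>{a, b, c}. d e * p e j) = 0"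
    then have "\<forall>j<r. d a * p a j + d b * p b j + d c * p c j = 0"
      using assms by (simp add: add.assoc)
    then have "d a = 0 \<and> d b = 0 \<and> d c = 0" using R by blast
    then show "\<forall>e\<in>{a, b, c}. d e = 0" by simp
  qed
qed

section \<open>Determinants and independence in dimension three\<close>

definition det3 :: "(nat \<Rightarrow> 'k::field) \<Rightarrow> (nat \<Rightarrow> 'k) \<Rightarrow> (nat \<Rightarrow> 'k) \<Rightarrow> 'k" where
  "det3 u v w = u 0 * (v 1 * w 2 - v 2 * w 1) + u 1 * (v 2 * w 0 - v 0 * w 2)
    + u 2 * (v 0 * w 1 - v 1 * w 0)"

lemma all_less_3: "(\<forall>j<3. P j) \<longleftrightarrow> P 0 \<and> P 1 \<and> P (2::nat)"
  by (auto simp: numeral_3_eq_3 numeral_2_eq_2 less_Suc_eq)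

text \<open>Cramer's rule: adding the three equations with cofactors as weights leaves one unknown
  times the determinant.\<close>

lemma det3_nonzero_imp_trivial:
  assumes d: "det3 u v w \<noteq> 0" and eq: "\<forall>j<3. x * u j + y * v j + z * w j = 0"
  shows "x = 0 \<and> y = 0 \<and> z = 0"
proof -
  define E0 E1 E2 where "E0 = x * u 0 + y * v 0 + z * w 0" "E1 = x * u 1 + y * v 1 + z * w 1"
    "E2 = x * u 2 + y * v 2 + z * w 2"
  have z: "E0 = 0" "E1 = 0" "E2 = 0" using eq by (simp_all add: all_less_3 E0_E1_E2_def)
  have "x * det3 u v w = E0 * (v 1 * w 2 - v 2 * w 1) + E1 * (v 2 * w 0 - v 0 * w 2) + E2 * (v 0 * w 1 - v 1 * w 0)"
    by (simp add: det3_def E0_E1_E2_def algebra_simps)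
  moreover have "y * det3 u v w = E0 * (w 1 * u 2 - w 2 * u 1) + E1 * (w 2 * u 0 - w 0 * u 2) + E2 * (w 0 * u 1 - w 1 * u 0)"
    by (simp add: det3_def E0_E1_E2_def algebra_simps)
  moreover have "z * det3 u v w = E0 * (u 1 * v 2 - u 2 * v 1) + E1 * (u 2 * v 0 - u 0 * v 2) + E2 * (u 0 * v 1 - u 1 * v 0)"
    by (simp add: det3_def E0_E1_E2_def algebra_simps)
  ultimately show ?thesis using d z by simp
qed

text \<open>
  A nonzero row of cofactors is a nontrivial relation; if all cofactors vanish, then already \<open>u\<close>
  and \<open>v\<close> are proportional.
\<close>

lemma det3_zero_imp_nontrivial:
  assumes d: "det3 u v w = 0"
  shows "\<exists>x y z. (\<forall>j<3. x * u j + y * v j + z * w j = 0) \<and> \<not> (x = 0 \<and> y = 0 \<and> z = 0)"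
proof -
  define M where "M i j = (v i * w j - v j * w i, w i * u j - w j * u i, u i * v j - u j * v i)" for i j
  have rel: ?thesis if "M i j \<noteq> (0, 0, 0)" "(i, j) \<in> {(0, 1), (1, 2), (2, 0)}" for i j
  proof (intro exI conjI)
    \<comment> \<open>For \<open>k\<close> equal to \<open>i\<close> or \<open>j\<close> this
      expands a determinant with a repeated row; for the third index it is
      \<open>det3 u v w\<close>, which vanishes by assumption.\<close>
    show "\<forall>k<3. (v i * w j - v j * w i) * u k + (w i * u j - w j * u i) * v k
        + (u i * v j - u j * v i) * w k = 0"
      using that(2) d by (auto simp: all_less_3 det3_def algebra_simps)
    show "\<not> (v i * w j - v j * w i = 0 \<and> w i * u j - w j * u i = 0 \<and> u i * v j - u j * v i = 0)"
      using that(1) by (simp add: M_def)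
  qed
  show ?thesis
  proof (cases "M 0 1 = (0, 0, 0) \<and> M 1 2 = (0, 0, 0) \<and> M 2 0 = (0, 0, 0)")
    case False
    then show ?thesis using rel by blast
  next
    case True
    then have uv: "\<forall>i<3. \<forall>j<3. u i * v j - u j * v i = 0"
      by (auto simp: all_less_3 M_def mult.commute)
    show ?thesis
    proof (cases "\<exists>i<3. u i \<noteq> 0")
      case True
      then obtain i where i: "i < 3" "u i \<noteq> 0" by blast
      have "\<forall>j<3. v i * u j + (- u i) * v j + 0 * w j = 0"
        using uv i(1) by (auto simp: algebra_simps)
      then show ?thesis using i(2) by (metis neg_equal_0_iff_equal)
    next
      case False
      then have "\<forall>j<3. 1 * u j + 0 * v j + 0 * w j = 0" by simp
      then show ?thesis by (metis zero_neq_one)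
    qed
  qed
qed

lemma indep_family_triple_iff_det3:
  assumes "a \<noteq> b" "a \<noteq> c" "b \<noteq> c"
  shows "indep_family 3 p {a, b, c} \<longleftrightarrow> det3 (p a) (p b) (p c) \<noteq> 0"
proof (cases "det3 (p a) (p b) (p c) = 0")
  case True
  then show ?thesis
    using det3_zero_imp_nontrivial[OF True] unfolding indep_family_triple[OF assms] by blast
next
  case False
  then show ?thesis
    using det3_nonzero_imp_trivial[OF False] unfolding indep_family_triple[OF assms] by blast
qed

lemma indep_family_3_card:
  assumes "indep_family 3 p X" "finite X"
  shows "card X \<le> 3"
proof (rule ccontr)
  assume "\<not> card X \<le> 3"
  then obtain Y where Y: "Y \<subseteq> X" "card Y = Suc 3" "finite Y"
    by (meson not_less_eq_eq obtain_subset_with_card_n)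
  then obtain d Z where Z: "Y = insert d Z" "d \<notin> Z" "card Z = 3"
    by (metis card_Suc_eq)
  then obtain a b c where abc: "Z = {a, b, c}" "a \<noteq> b" "a \<noteq> c" "b \<noteq> c"
    by (auto simp: card_3_iff)
  have Yi: "indep_family 3 p Y" using indep_family_subset assms Y by blast
  then have "indep_family 3 p Z" using indep_family_subset Y Z by blast
  then have det: "det3 (p a) (p b) (p c) \<noteq> 0" using abc indep_family_triple_iff_det3 by metis
  \<comment> \<open>The alternating 3 by 3 minors of four vectors give a linear relation. The
    coefficient of \<open>d\<close> is nonzero since \<open>a\<close>, \<open>b\<close>,
    \<open>c\<close> are independent.\<close>
  define k where "k = (\<lambda>_. 0)(a := det3 (p b) (p c) (p d), b := - det3 (p a) (p c) (p d),
    c := det3 (p a) (p b) (p d), d := - det3 (p a) (p b) (p c))"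
  have k: "k a = det3 (p b) (p c) (p d)" "k b = - det3 (p a) (p c) (p d)"
    "k c = det3 (p a) (p b) (p d)" "k d = - det3 (p a) (p b) (p c)"
    using abc Z by (auto simp: k_def)
  have sum: "(\<Sum>e\<in>Y. k e * p e j) = k d * p d j + (k a * p a j + (k b * p b j + k c * p c j))" for j
    using abc Z by simp
  have "\<forall>j<3. k d * p d j + (k a * p a j + (k b * p b j + k c * p c j)) = 0"
    unfolding k by (simp add: all_less_3 det3_def algebra_simps)
  then have "\<forall>j<3. (\<Sum>e\<in>Y. k e * p e j) = 0" by (simp only: sum)
  then have "k d = 0" using Yi[unfolded indep_family_def] Z(1) by blast
  then show False using det by (simp add: k)
qed

lemma (in matroid) indep_extend_card:
  assumes "indep X" "indep B" "card X \<le> card B"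
  shows "\<exists>Y. X \<subseteq> Y \<and> indep Y \<and> card Y = card B"
  using assms(1,3)
proof (induction "card B - card X" arbitrary: X)
  case 0
  then show ?case by auto
next
  case (Suc n)
  then obtain y where y: "y \<in> B - X" "indep (insert y X)"
    using indep_augment[OF Suc.prems(1) assms(2)] Suc.hyps(2) by fastforce
  have "finite X" using Suc.prems indep_ground finite_ground finite_subset by blast
  then have "card (insert y X) = Suc (card X)" using y by simp
  then have "n = card B - card (insert y X)" "card (insert y X) \<le> card B"
    using Suc.hyps(2) by simp_all
  from Suc.hyps(1)[OF this(1) y(2) this(2)] show ?case by blast
qed

text \<open>Triples decide everything: an independent set extends to an independent triple by
  augmentation from \<open>B\<close>, and independence of vectors passes to subsets. Conversely, no
  more than three vectors are independent in dimension three, and smaller sets of points are always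
  independent.\<close>

lemma representable_line_indep:
  fixes p :: "'e \<Rightarrow> nat \<Rightarrow> 'k::field"
  assumes M: "matroid E (line_indep E \<L>)" and B: "line_indep E \<L> B" "card B = 3"
    and det: "\<And>a b c. {a, b, c} \<subseteq> E \<Longrightarrow> a \<noteq> b \<Longrightarrow> a \<noteq> c \<Longrightarrow> b \<noteq> c \<Longrightarrow>
      det3 (p a) (p b) (p c) = 0 \<longleftrightarrow> (\<exists>l\<in>\<L>. {a, b, c} \<subseteq> l)"
  shows "representable TYPE('k) E (line_indep E \<L>)"
proof -
  interpret matroid E "line_indep E \<L>" by fact
  have triple: "line_indep E \<L> X \<longleftrightarrow> indep_family 3 p X" if "X \<subseteq> E" "card X = 3" for X
  proof -
    obtain a b c where abc: "X = {a, b, c}" "a \<noteq> b" "a \<noteq> c" "b \<noteq> c"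
      using \<open>card X = 3\<close> by (auto simp: card_3_iff)
    then show ?thesis
      using that det[of a b c] indep_family_triple_iff_det3[OF abc(2-4), of p]
      by (auto simp: line_indep_def)
  qed
  have "line_indep E \<L> X \<longleftrightarrow> indep_family 3 p X" if "X \<subseteq> E" for X
  proof
    assume X: "line_indep E \<L> X"
    then obtain Y where Y: "X \<subseteq> Y" "line_indep E \<L> Y" "card Y = 3"
      using indep_extend_card[OF X B(1)] B(2) by (auto simp: line_indep_def)
    then have "indep_family 3 p Y" using triple indep_ground by blast
    then show "indep_family 3 p X"
      using Y indep_ground finite_ground finite_subset indep_family_subset by metis
  next
    assume X: "indep_family 3 p X"
    have "card X \<le> 3"
      using indep_family_3_card[OF X] that finite_ground finite_subset by blast
    then show "line_indep E \<L> X"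
      using X triple[OF that] that by (cases "card X = 3") (auto simp: line_indep_def)
  qed
  then show ?thesis
    using representable_iff_indep_family[OF finite_ground] by blast
qed

text \<open>Independence of the three pairs makes all coefficients of the relation nonzero. So it
  can be solved for \<open>e\<close>, and \<open>g\<close> is minus the ratio of the coefficients of
  \<open>v\<close> and \<open>u\<close>.\<close>

lemma line_gain:
  fixes p :: "'e \<Rightarrow> nat \<Rightarrow> 'k::field"
  assumes ne: "u \<noteq> v" "u \<noteq> e" "v \<noteq> e"
    and ind: "indep_family r p {u, v}" "indep_family r p {u, e}" "indep_family r p {v, e}"
    and dep: "\<not> indep_family r p {u, v, e}"
  obtains \<alpha> g where "\<alpha> \<noteq> 0" "g \<noteq> 0" "\<And>j. j < r \<Longrightarrow> p e j = \<alpha> * (p u j - g * p v j)"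
proof -
  obtain x y z where eq: "\<forall>j<r. x * p u j + y * p v j + z * p e j = 0" and nz: "\<not> (x = 0 \<and> y = 0 \<and> z = 0)"
    using dep indep_family_triple[OF ne] by blast
  have z: "z \<noteq> 0"
  proof
    assume "z = 0"
    then have "\<forall>j<r. x * p u j + y * p v j = 0" using eq by simp
    then show False using ind(1) \<open>z = 0\<close> nz indep_family_pair[OF ne(1)] by blast
  qed
  have x: "x \<noteq> 0"
  proof
    assume "x = 0"
    then have "\<forall>j<r. y * p v j + z * p e j = 0" using eq by simp
    then show False using ind(3) z indep_family_pair[OF ne(3)] by blast
  qed
  have y: "y \<noteq> 0"
  proof
    assume "y = 0"
    then have "\<forall>j<r. x * p u j + z * p e j = 0" using eq by simp
    then show False using ind(2) z indep_family_pair[OF ne(2)] by blast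
  qed
  show thesis
  proof
    show "- x / z \<noteq> 0" "- y / x \<noteq> 0" using x y z by simp_all
    fix j assume "j < r"
    then have "z * p e j = - (x * p u j + y * p v j)" using eq by (metis add_eq_0_iff)
    then have "p e j = - (x * p u j + y * p v j) / z" using z by (metis nonzero_mult_div_cancel_left)
    also have "\<dots> = (- x / z) * (p u j - (- y / x) * p v j)" using x z by (simp add: field_simps)
    finally show "p e j = (- x / z) * (p u j - (- y / x) * p v j)" .
  qed
qed

text \<open>Substituting the three points into their relation gives a relation between
  \<open>u\<close>, \<open>v\<close>, \<open>w\<close>. These are independent, so its coefficients
  vanish, and eliminating \<open>b\<close> and \<open>c\<close> leaves
  \<open>a * \<alpha> * (g * h - k) = 0\<close>.\<close>

lemma gains_balanced:
  fixes p :: "'e \<Rightarrow> nat \<Rightarrow> 'k::field"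
  assumes ne: "u \<noteq> v" "u \<noteq> w" "v \<noteq> w" "x \<noteq> y" "x \<noteq> z" "y \<noteq> z"
    and ind: "indep_family r p {u, v, w}" and dep: "\<not> indep_family r p {x, y, z}"
    and nz: "\<alpha> \<noteq> 0" "\<beta> \<noteq> 0" "\<gamma> \<noteq> 0" "g \<noteq> 0"
    and x: "\<And>j. j < r \<Longrightarrow> p x j = \<alpha> * (p u j - g * p v j)"
    and y: "\<And>j. j < r \<Longrightarrow> p y j = \<beta> * (p v j - h * p w j)"
    and z: "\<And>j. j < r \<Longrightarrow> p z j = \<gamma> * (p u j - k * p w j)"
  shows "k = g * h"
proof -
  obtain a b c where eq: "\<forall>j<r. a * p x j + b * p y j + c * p z j = 0" and n: "\<not> (a = 0 \<and> b = 0 \<and> c = 0)"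
    using dep indep_family_triple[OF ne(4-6)] by blast
  have "\<forall>j<r. (a * \<alpha> + c * \<gamma>) * p u j + (b * \<beta> - a * \<alpha> * g) * p v j
      + (- (b * \<beta> * h + c * \<gamma> * k)) * p w j = 0"
  proof (intro allI impI)
    fix j assume "j < r"
    then have "a * (\<alpha> * (p u j - g * p v j)) + b * (\<beta> * (p v j - h * p w j)) + c * (\<gamma> * (p u j - k * p w j)) = 0"
      using eq x y z by auto
    then show "(a * \<alpha> + c * \<gamma>) * p u j + (b * \<beta> - a * \<alpha> * g) * p v j
      + (- (b * \<beta> * h + c * \<gamma> * k)) * p w j = 0" by (simp add: algebra_simps)
  qed
  then have eqs: "a * \<alpha> + c * \<gamma> = 0 \<and> b * \<beta> - a * \<alpha> * g = 0 \<and> - (b * \<beta> * h + c * \<gamma> * k) = 0"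
    using ind indep_family_triple[OF ne(1-3)] by blast
  have 1: "c * \<gamma> = - (a * \<alpha>)" using eqs by (simp only: add_eq_0_iff)
  have 2: "b * \<beta> = a * \<alpha> * g" using eqs by (simp only: right_minus_eq)
  have 3: "b * \<beta> * h + c * \<gamma> * k = 0" using eqs by (simp only: neg_equal_0_iff_equal)
  have "a \<noteq> 0"
  proof
    assume "a = 0"
    then have "c = 0" "b = 0" using 1 2 nz by simp_all
    then show False using n \<open>a = 0\<close> by simp
  qed
  moreover have "a * \<alpha> * (g * h - k) = 0"
    using 3 unfolding 1 2 by (simp add: algebra_simps)
  ultimately show ?thesis using nz(1) by simp
qed

text \<open>Equal gains would make the two vectors proportional.\<close>

lemma gains_distinct:
  fixes p :: "'e \<Rightarrow> nat \<Rightarrow> 'k::field"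
  assumes "x \<noteq> y" "indep_family r p {x, y}" "\<alpha> \<noteq> 0"
    and x: "\<And>j. j < r \<Longrightarrow> p x j = \<alpha> * (p u j - g * p v j)"
    and y: "\<And>j. j < r \<Longrightarrow> p y j = \<beta> * (p u j - h * p v j)"
  shows "g \<noteq> h"
proof
  assume "g = h"
  then have "\<forall>j<r. \<beta> * p x j + (- \<alpha>) * p y j = 0" using x y by simp
  then have "- \<alpha> = 0" using assms(2) indep_family_pair[OF assms(1)] by blast
  then show False using assms(3) by simp
qed

section \<open>Ladder matroids\<close>

text \<open>The \<open>Ji\<close> are the corners of the triangle. The flag of \<open>Node\<close>,
  \<open>Mid\<close> and \<open>Link\<close> names a rail. The points \<open>Shift\<close> and
  \<open>End\<close> are shared by both rails: \<open>End False\<close> belongs to the first nodes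
  of the rails and \<open>End True\<close> to the last ones.\<close>

datatype element = J1 | J2 | J3 | Shift bool | Link bool | End bool | Node bool nat | Mid bool nat

instance element :: countable
  by countable_datatype

definition line1 :: "(bool \<Rightarrow> nat) \<Rightarrow> element set" where
  "line1 l = {J1, J2} \<union> {Node b i | b i. i \<le> l b}"

definition line2 :: "element set" where
  "line2 = {J2, J3} \<union> range Shift \<union> range Link"

definition line3 :: "(bool \<Rightarrow> nat) \<Rightarrow> element set" where
  "line3 l = {J1, J3} \<union> range End \<union> {Mid b i | b i. i < l b}"

text \<open>
  In a representation, a point on the line through \<open>Ji\<close> and \<open>Jj\<close> is a multiple of \<open>Ji - g * Jj\<close>
  for a nonzero gain \<open>g\<close>. Three such points on \<open>line1\<close>, \<open>line2\<close> and \<open>line3\<close> are collinear iff the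
  gain of the third is the product of the gains of the other two. Hence the triples with \<open>Shift\<close> make the gains of \<open>Node b 0, \<dots>, Node b (l b)\<close> a geometric progression with
  the same ratio for both \<open>b\<close>, and those with \<open>Link\<close> equate \<open>gain (Node b (l b)) / gain (Node b 0)\<close>
  for both \<open>b\<close>.
\<close>

definition triples :: "(bool \<Rightarrow> nat) \<Rightarrow> (element \<times> element \<times> element) set" where
  "triples l = {(Node b (i + of_bool s), Shift s, Mid b i) | b i s. i < l b} \<union>
    {(Node b (if t then l b else 0), Link b, End t) | b t. True}"

definition lines :: "(bool \<Rightarrow> nat) \<Rightarrow> element set set" where
  "lines l = {line1 l, line2, line3 l} \<union> (\<lambda>(x, y, z). {x, y, z}) ` triples l"

definition ground :: "(bool \<Rightarrow> nat) \<Rightarrow> element set" where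
  "ground l = line1 l \<union> line2 \<union> line3 l"

abbreviation ladder_indep :: "(bool \<Rightarrow> nat) \<Rightarrow> element set \<Rightarrow> bool" where
  "ladder_indep l \<equiv> line_indep (ground l) (lines l)"

section \<open>Ladders are matroids\<close>

lemma finite_ground: "finite (ground l)"
proof -
  have "{Node b i | b i. i \<le> l b} = (\<lambda>(b, i). Node b i) ` (SIGMA b:UNIV. {..l b})"
    "{Mid b i | b i. i < l b} = (\<lambda>(b, i). Mid b i) ` (SIGMA b:UNIV. {..<l b})"
    by auto
  then show ?thesis by (simp add: ground_def line1_def line2_def line3_def)
qed

lemma triplesE:
  assumes "(x, y, z) \<in> triples l"
  obtains (shift) b i s where "i < l b" "x = Node b (i + of_bool s)" "y = Shift s" "z = Mid b i"
    | (link) b t where "x = Node b (if t then l b else 0)" "y = Link b" "z = End t"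
  using assms unfolding triples_def by blast

text \<open>Positive lengths matter: if \<open>l b\<close> were 0, the link triples of
  \<open>End False\<close> and \<open>End True\<close> would share both their node and
  \<open>Link b\<close>.\<close>

lemma triples_unique:
  assumes "\<And>b. l b \<noteq> 0" "(x, y, z) \<in> triples l" "(x', y', z') \<in> triples l"
    and "x = x' \<and> y = y' \<or> x = x' \<and> z = z' \<or> y = y' \<and> z = z'"
  shows "x = x' \<and> y = y' \<and> z = z'"
  using assms(2)
proof (cases rule: triplesE)
  case (shift b i s)
  from assms(3) show ?thesis
    by (cases rule: triplesE) (use shift assms(4) in \<open>auto simp: of_bool_def split: if_splits\<close>)
next
  case (link b t)
  from assms(3) show ?thesis
    by (cases rule: triplesE) (use link assms(1)[of b] assms(4) in \<open>auto split: if_splits\<close>)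
qed

lemma linesE:
  assumes "k \<in> lines l"
  obtains (long) "k \<in> {line1 l, line2, line3 l}" | (triple) x y z where "(x, y, z) \<in> triples l" "k = {x, y, z}"
proof (cases "k \<in> {line1 l, line2, line3 l}")
  case True
  then show ?thesis by (rule long)
next
  case False
  then obtain t where "t \<in> triples l" "k = (\<lambda>(x, y, z). {x, y, z}) t"
    using assms unfolding lines_def by blast
  then show ?thesis using triple by (cases t) simp
qed

lemma long_lines_unique:
  assumes "k \<in> {line1 l, line2, line3 l}" "k' \<in> {line1 l, line2, line3 l}" "a \<noteq> b" "{a, b} \<subseteq> k" "{a, b} \<subseteq> k'"
  shows "k = k'"
proof (rule ccontr)
  assume "k \<noteq> k'"
  then have "\<exists>c. k \<inter> k' \<subseteq> {c}"
    using assms(1,2) by (elim insertE emptyE) (auto simp: line1_def line2_def line3_def)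
  then show False using assms(3-5) by blast
qed

lemma triple_inter_long_line:
  assumes "(x, y, z) \<in> triples l"
  shows "{x, y, z} \<inter> line1 l \<subseteq> {x}" "{x, y, z} \<inter> line2 \<subseteq> {y}" "{x, y, z} \<inter> line3 l \<subseteq> {z}"
  by (cases rule: triplesE[OF assms]; auto simp: line1_def line2_def line3_def)+

text \<open>Two sides of the triangle share only a corner, a triple has at most one point on each
  side, and triples with two common points coincide.\<close>

lemma lines_unique:
  assumes pos: "\<And>b. 0 < l b" and k: "k \<in> lines l" "k' \<in> lines l"
    and ab: "a \<noteq> b" "{a, b} \<subseteq> k" "{a, b} \<subseteq> k'"
  shows "k = k'"
proof -
  have mixed: False if "k \<in> {line1 l, line2, line3 l}" "(x, y, z) \<in> triples l"
    "{a, b} \<subseteq> k" "{a, b} \<subseteq> {x, y, z}" for k x y z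
  proof -
    have "\<exists>c. {x, y, z} \<inter> k \<subseteq> {c}"
      using that(1)
    proof (elim insertE emptyE)
      assume "k = line1 l"
      then show ?thesis using triple_inter_long_line(1)[OF that(2)] by (metis)
    next
      assume "k = line2"
      then show ?thesis using triple_inter_long_line(2)[OF that(2)] by (metis)
    next
      assume "k = line3 l"
      then show ?thesis using triple_inter_long_line(3)[OF that(2)] by (metis)
    qed
    then obtain c where "{x, y, z} \<inter> k \<subseteq> {c}" ..
    then have "a = c" "b = c" using that(3,4) by auto
    then show False using ab(1) by simp
  qed
  from k(1) show ?thesis
  proof (cases rule: linesE)
    case long
    from k(2) show ?thesis
    proof (cases rule: linesE)
      case long': long
      then show ?thesis using long_lines_unique[OF long long' ab] by simp
    next
      case (triple x y z)
      then show ?thesis using mixed[OF long triple(1)] ab by simp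
    qed
  next
    case (triple x y z)
    from k(2) show ?thesis
    proof (cases rule: linesE)
      case long
      then show ?thesis using mixed[OF long triple(1)] triple(2) ab by simp
    next
      case t': (triple x' y' z')
      \<comment> \<open>Points in different positions of triples have different constructors, so
        common points sit in the same position.\<close>
      have ne: "x \<noteq> y'" "x \<noteq> z'" "y \<noteq> x'" "y \<noteq> z'" "z \<noteq> x'" "z \<noteq> y'"
        by (cases rule: triplesE[OF triple(1)]; cases rule: triplesE[OF t'(1)]; simp)+
      have "x = x' \<and> y = y' \<or> x = x' \<and> z = z' \<or> y = y' \<and> z = z'"
        using ab ne unfolding triple(2) t'(2) by blast
      moreover have "l b \<noteq> 0" for b using pos[of b] by simp
      ultimately show ?thesis
        using triples_unique[OF _ triple(1) t'(1)] triple(2) t'(2) by blast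
    qed
  qed
qed

lemma matroid_ladder:
  assumes "\<And>b. 0 < l b"
  shows "matroid (ground l) (ladder_indep l)"
  by (rule matroid_line_indep[OF finite_ground]) (rule lines_unique[OF assms])

lemma shift_triple: "i < l b \<Longrightarrow> (Node b (i + of_bool s), Shift s, Mid b i) \<in> triples l"
  unfolding triples_def by blast

lemma link_triple: "(Node b (if t then l b else 0), Link b, End t) \<in> triples l"
  unfolding triples_def by blast

lemma triple_in_lines: "(x, y, z) \<in> triples l \<Longrightarrow> {x, y, z} \<in> lines l"
  unfolding lines_def by (rule UnI2, rule image_eqI[of _ _ "(x, y, z)"]) simp_all

lemma ladder_indep_pair:
  assumes "a \<in> ground l" "b \<in> ground l"
  shows "ladder_indep l {a, b}"
  using assms by (cases "a = b") (simp_all add: line_indep_def)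

lemma ladder_dep_triple:
  assumes "k \<in> lines l" "{a, b, c} \<subseteq> k" "a \<noteq> b" "a \<noteq> c" "b \<noteq> c"
  shows "\<not> ladder_indep l {a, b, c}"
  using assms by (auto simp: line_indep_def)

lemma ladder_indep_joints: "ladder_indep l {J1, J2, J3}"
proof -
  have "\<not> {J1, J2, J3} \<subseteq> k" if "k \<in> lines l" for k
    using that
  proof (cases rule: linesE)
    case long
    then show ?thesis by (elim insertE emptyE) (auto simp: line1_def line2_def line3_def)
  next
    case (triple x y z)
    then show ?thesis by (cases rule: triplesE[OF triple(1)]) simp_all
  qed
  then show ?thesis by (simp add: line_indep_def ground_def line1_def line2_def line3_def)
qed

text \<open>The gains along each rail form a progression with ratio \<open>\<rho>\<close>, and the
  links force \<open>\<rho> ^ l True = \<rho> ^ l False\<close>. Unequal lengths would make a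
  positive power of \<open>\<rho>\<close> equal to 1, hence two nodes of the longer rail
  parallel.\<close>

lemma ladder_representable_imp:
  assumes rep: "representable TYPE('k::field) (ground l) (ladder_indep l)"
  shows "l True = l False"
proof -
  obtain r and p :: "element \<Rightarrow> nat \<Rightarrow> 'k" where
    p: "\<And>X. X \<subseteq> ground l \<Longrightarrow> ladder_indep l X \<longleftrightarrow> indep_family r p X"
    using rep representable_iff_indep_family[OF finite_ground, of l] by blast
  have pair: "indep_family r p {a, b}" if "a \<in> ground l" "b \<in> ground l" for a b
    using p[of "{a, b}"] ladder_indep_pair that by simp
  define G where "G u v e g \<longleftrightarrow> g \<noteq> 0 \<and> (\<exists>\<alpha>. \<alpha> \<noteq> 0 \<and> (\<forall>j<r. p e j = \<alpha> * (p u j - g * p v j)))"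
    for u v e and g :: 'k
  have line_G: "\<exists>g. G u v e g" if uve: "k \<in> {line1 l, line2, line3 l}" "{u, v, e} \<subseteq> k" "u \<noteq> v" "u \<noteq> e" "v \<noteq> e"
    for k u v e
  proof -
    have "k \<in> lines l" using uve(1) unfolding lines_def by (rule UnI1)
    moreover have sub: "{u, v, e} \<subseteq> ground l" using uve(1,2) by (auto simp: ground_def)
    ultimately have "\<not> indep_family r p {u, v, e}" using ladder_dep_triple uve p by metis
    moreover have "indep_family r p {u, v}" "indep_family r p {u, e}" "indep_family r p {v, e}"
      using sub pair by simp_all
    ultimately obtain \<alpha> g where "\<alpha> \<noteq> 0" "g \<noteq> 0" "\<And>j. j < r \<Longrightarrow> p e j = \<alpha> * (p u j - g * p v j)"
      using line_gain[OF uve(3-5)] by metis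
    then show ?thesis unfolding G_def by metis
  qed
  have joints: "indep_family r p {J1, J2, J3}"
    using p[of "{J1, J2, J3}"] ladder_indep_joints by (simp add: ground_def line1_def line2_def)
  have G_triple: "k = g * h" if t: "(x, y, z) \<in> triples l" and G: "G J1 J2 x g" "G J2 J3 y h" "G J1 J3 z k"
    for x y z g h k
  proof -
    have ne: "x \<noteq> y" "x \<noteq> z" "y \<noteq> z" by (cases rule: triplesE[OF t]; simp)+
    have sub: "{x, y, z} \<subseteq> ground l"
      by (cases rule: triplesE[OF t]) (auto simp: ground_def line1_def line2_def line3_def)
    have "{x, y, z} \<in> lines l" using t by (rule triple_in_lines)
    then have dep: "\<not> indep_family r p {x, y, z}" using ladder_dep_triple[OF _ subset_refl ne] p[OF sub] by blast
    obtain \<alpha> \<beta> \<gamma> where nz: "\<alpha> \<noteq> 0" "\<beta> \<noteq> 0" "\<gamma> \<noteq> 0" "g \<noteq> 0"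
      and eqs: "\<And>j. j < r \<Longrightarrow> p x j = \<alpha> * (p J1 j - g * p J2 j)"
      "\<And>j. j < r \<Longrightarrow> p y j = \<beta> * (p J2 j - h * p J3 j)"
      "\<And>j. j < r \<Longrightarrow> p z j = \<gamma> * (p J1 j - k * p J3 j)"
      using G unfolding G_def by metis
    show ?thesis by (rule gains_balanced[OF _ _ _ ne joints dep nz eqs]) simp_all
  qed
  define x where "x b i = (SOME g. G J1 J2 (Node b i) g)" for b i
  have x: "G J1 J2 (Node b i) (x b i)" if "i \<le> l b" for b i
    unfolding x_def by (rule someI_ex, rule line_G[of "line1 l"]) (use that in \<open>simp_all add: line1_def\<close>)
  define q where "q s = (SOME g. G J2 J3 (Shift s) g)" for s
  have q: "G J2 J3 (Shift s) (q s)" for s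
    unfolding q_def by (rule someI_ex, rule line_G[of line2]) (simp_all add: line2_def)
  define w where "w b = (SOME g. G J2 J3 (Link b) g)" for b
  have w: "G J2 J3 (Link b) (w b)" for b
    unfolding w_def by (rule someI_ex, rule line_G[of line2]) (simp_all add: line2_def)
  define e where "e t = (SOME g. G J1 J3 (End t) g)" for t
  have e: "G J1 J3 (End t) (e t)" for t
    unfolding e_def by (rule someI_ex, rule line_G[of "line3 l"]) (simp_all add: line3_def)
  define z where "z b i = (SOME g. G J1 J3 (Mid b i) g)" for b i
  have z: "G J1 J3 (Mid b i) (z b i)" if "i < l b" for b i
    unfolding z_def by (rule someI_ex, rule line_G[of "line3 l"]) (use that in \<open>simp_all add: line3_def\<close>)
  have nz: "q s \<noteq> 0" "e t \<noteq> 0" "x b 0 \<noteq> 0" for s t b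
    using q[of s] e[of t] x[of 0 b] by (simp_all add: G_def)
  \<comment> \<open>Two consecutive nodes meet in the same \<open>Mid b i\<close> through the two
    shifts. Equating the two expressions for its gain yields this ratio.\<close>
  define \<rho> where "\<rho> = q False / q True"
  have step: "x b (Suc i) = x b i * \<rho>" if "i < l b" for b i
  proof -
    have "(Node b i, Shift False, Mid b i) \<in> triples l" "(Node b (Suc i), Shift True, Mid b i) \<in> triples l"
      using shift_triple[of i l b False] shift_triple[of i l b True] that by simp_all
    then have "z b i = x b i * q False" "z b i = x b (Suc i) * q True"
      using that by (auto intro: G_triple[OF _ x q z])
    then show ?thesis using nz by (simp add: \<rho>_def field_simps)
  qed
  have pow: "x b i = x b 0 * \<rho> ^ i" if "i \<le> l b" for b i
    using that by (induction i) (simp_all add: step)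
  \<comment> \<open>The unknown gain \<open>w b\<close> cancels between the two ends, and neither
    \<open>e True\<close> nor \<open>e False\<close> depends on \<open>b\<close>.\<close>
  have "e True = e False * \<rho> ^ l b" for b
  proof -
    have "(Node b 0, Link b, End False) \<in> triples l" "(Node b (l b), Link b, End True) \<in> triples l"
      using link_triple[of b False l] link_triple[of b True l] by simp_all
    then have "e False = x b 0 * w b" "e True = x b (l b) * w b"
      by (auto intro: G_triple[OF _ x w e])
    then show ?thesis using pow[of "l b" b] by simp
  qed
  then have eq: "\<rho> ^ l b = \<rho> ^ l b'" for b b' using nz by (metis mult_cancel_left)
  have \<rho>: "\<rho> \<noteq> 0" using nz by (simp add: \<rho>_def)
  have "\<not> l b' < l b" for b b'
  proof
    assume less: "l b' < l b"
    \<comment> \<open>The difference is positive and at most \<open>l b\<close>, so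
      \<open>Node b ?d\<close> is a point of the longer rail other than
      \<open>Node b 0\<close>.\<close>
    let ?d = "l b - l b'"
    have "\<rho> ^ l b' * \<rho> ^ ?d = \<rho> ^ l b" using less by (simp flip: power_add)
    then have "\<rho> ^ ?d = 1" using eq[of b b'] \<rho> by simp
    then have "x b ?d = x b 0" using pow[of ?d b] by simp
    obtain \<alpha> \<beta> where ab: "\<alpha> \<noteq> 0" "\<And>j. j < r \<Longrightarrow> p (Node b 0) j = \<alpha> * (p J1 j - x b 0 * p J2 j)"
      "\<And>j. j < r \<Longrightarrow> p (Node b ?d) j = \<beta> * (p J1 j - x b ?d * p J2 j)"
      using x[of 0 b, unfolded G_def] x[of ?d b, unfolded G_def] by auto
    have "Node b 0 \<in> ground l" "Node b ?d \<in> ground l" by (auto simp: ground_def line1_def)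
    then have "indep_family r p {Node b 0, Node b ?d}" by (rule pair)
    from gains_distinct[OF _ this ab] have "x b 0 \<noteq> x b ?d" using less by simp
    then show False using \<open>x b ?d = x b 0\<close> by simp
  qed
  then show ?thesis using linorder_neqE_nat by blast
qed

section \<open>Representing ladders with rails of equal length\<close>

text \<open>Normal forms of the vectors to be used: the corners, and the points with a given gain on
  each side. Working with constructors turns collinearity into a finite case analysis.\<close>

datatype 'k point = E1 | E2 | E3 | L1 'k | L2 'k | L3 'k

fun coords :: "'k::field point \<Rightarrow> nat \<Rightarrow> 'k" where
  "coords E1 = (\<lambda>_. 0)(0 := 1)"
| "coords E2 = (\<lambda>_. 0)(1 := 1)"
| "coords E3 = (\<lambda>_. 0)(2 := 1)"
| "coords (L1 g) = (\<lambda>_. 0)(0 := 1, 1 := - g)"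
| "coords (L2 g) = (\<lambda>_. 0)(1 := 1, 2 := - g)"
| "coords (L3 g) = (\<lambda>_. 0)(0 := 1, 2 := - g)"

definition balanced :: "'k::field point \<Rightarrow> 'k point \<Rightarrow> 'k point \<Rightarrow> bool" where
  "balanced x y z \<longleftrightarrow> (\<exists>g h. x = L1 g \<and> y = L2 h \<and> z = L3 (g * h))"

text \<open>With one point on each side the determinant is, up to sign, \<open>g * h - k\<close>.
  Gain zero is excluded because such a point has the coordinates of a corner.\<close>

lemma det3_coords_eq_0_iff:
  assumes "a \<noteq> b" "a \<noteq> c" "b \<noteq> c" and nz: "{a, b, c} \<inter> {L1 0, L2 0, L3 0} = {}"
  shows "det3 (coords a) (coords b) (coords c) = 0 \<longleftrightarrow>
    {a, b, c} \<subseteq> {E1, E2} \<union> range L1 \<or> {a, b, c} \<subseteq> {E2, E3} \<union> range L2 \<or> {a, b, c} \<subseteq> {E1, E3} \<union> range L3 \<or>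
    balanced a b c \<or> balanced a c b \<or> balanced b a c \<or> balanced b c a \<or> balanced c a b \<or> balanced c b a"
  using assms
  by (cases a; cases b; cases c; simp add: det3_def balanced_def image_iff; fastforce)

text \<open>
  Logarithms of the gains. The equation \<open>exponent x + exponent y = exponent z\<close> holds for the triples
  only: the offset \<open>n + 2\<close> keeps the two rails apart, and the offset \<open>2 * n + 3\<close> keeps the points
  \<open>Link\<close> and \<open>End\<close> away from the others.
\<close>

fun exponent :: "nat \<Rightarrow> element \<Rightarrow> nat" where
  "exponent n (Node b i) = i + (if b then 0 else n + 2)"
| "exponent n (Shift s) = (if s then 0 else 1)"
| "exponent n (Link b) = 2 * n + 3 + (if b then n + 2 else 0)"
| "exponent n (Mid b i) = i + 1 + (if b then 0 else n + 2)"
| "exponent n (End t) = 3 * n + 5 + (if t then n else 0)"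
| "exponent n _ = 0"

fun place :: "(element \<Rightarrow> 'k) \<Rightarrow> element \<Rightarrow> 'k point" where
  "place \<gamma> J1 = E1"
| "place \<gamma> J2 = E2"
| "place \<gamma> J3 = E3"
| "place \<gamma> (Node b i) = L1 (\<gamma> (Node b i))"
| "place \<gamma> (Shift s) = L2 (\<gamma> (Shift s))"
| "place \<gamma> (Link b) = L2 (\<gamma> (Link b))"
| "place \<gamma> (Mid b i) = L3 (\<gamma> (Mid b i))"
| "place \<gamma> (End t) = L3 (\<gamma> (End t))"

lemma ground_iff:
  "Node b i \<in> ground l \<longleftrightarrow> i \<le> l b" "Mid b i \<in> ground l \<longleftrightarrow> i < l b"
  "J1 \<in> ground l" "J2 \<in> ground l" "J3 \<in> ground l" "Shift s \<in> ground l" "Link b \<in> ground l" "End t \<in> ground l"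
  by (simp_all add: ground_def line1_def line2_def line3_def image_iff)

lemma triples_const_iff:
  "(Node b i, Shift s, Mid b' j) \<in> triples (\<lambda>_. n) \<longleftrightarrow> b = b' \<and> i = j + of_bool s \<and> j < n"
  "(Node b i, Link b', End t) \<in> triples (\<lambda>_. n) \<longleftrightarrow> b = b' \<and> i = (if t then n else 0)"
  "(Node b i, Shift s, End t) \<notin> triples (\<lambda>_. n)"
  "(Node b i, Link b', Mid b'' j) \<notin> triples (\<lambda>_. n)"
  by (auto simp: triples_def)

text \<open>Sizes rule out the wrong combinations: a node plus a shift stays below every
  \<open>End\<close>, and a \<open>Link\<close> alone exceeds every \<open>Mid\<close>. Within the
  two right combinations, mismatched rails miss each other because of the offset
  \<open>n + 2\<close>.\<close>

lemma triples_exponent_iff: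
  assumes "x \<in> {Node b i | b i. i \<le> n}" "y \<in> range Shift \<union> range Link"
    "z \<in> range End \<union> {Mid b i | b i. i < n}"
  shows "(x, y, z) \<in> triples (\<lambda>_. n) \<longleftrightarrow> exponent n z = exponent n x + exponent n y"
proof -
  from assms(1) obtain b i where x: "x = Node b i" "i \<le> n" by blast
  from assms(2,3) consider s t where "y = Shift s" "z = End t" | s b' j where "y = Shift s" "z = Mid b' j" "j < n"
    | b' t where "y = Link b'" "z = End t" | b' b'' j where "y = Link b'" "z = Mid b'' j" "j < n"
    by blast
  then show ?thesis
    by cases (use x in \<open>auto simp: triples_const_iff of_bool_def\<close>)
qed

lemma exponent_le:
  assumes "x \<in> ground (\<lambda>_. n)"
  shows "exponent n x \<le> 4 * n + 5"
  using assms by (cases x) (auto simp: ground_iff)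

text \<open>The bound \<open>7 * n + 10\<close> also covers the sums of two exponents needed in
  \<open>balanced_place_iff\<close>. For \<open>n = 0\<close> the two \<open>End\<close> points
  would coincide.\<close>

lemma place_inj:
  assumes pow: "\<And>i j. i \<le> 7 * n + 10 \<Longrightarrow> j \<le> 7 * n + 10 \<Longrightarrow> c ^ i = c ^ j \<Longrightarrow> i = j" and n: "0 < n"
    and xy: "x \<in> ground (\<lambda>_. n)" "y \<in> ground (\<lambda>_. n)"
    and place: "place (\<lambda>x. c ^ exponent n x) x = place (\<lambda>x. c ^ exponent n x) y"
  shows "x = y"
proof -
  have "c ^ exponent n x = c ^ exponent n y"
    using place by (cases x; cases y) (simp_all del: exponent.simps(1-5))
  then have eq: "exponent n x = exponent n y"
    using exponent_le[OF xy(1)] exponent_le[OF xy(2)] by (intro pow) simp_all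
  show ?thesis
    by (cases x; cases y) (use place eq xy n in \<open>simp_all add: ground_iff split: if_splits\<close>)
qed

text \<open>For each positive \<open>k\<close> up to \<open>N\<close> the polynomial
  \<open>x ^ k - 1\<close> has finitely many roots, so an infinite field has a nonzero element
  avoiding them all. The bound is essential: in the algebraic closure of a finite field every
  nonzero element has finite order.\<close>

lemma infinite_field_distinct_powers:
  assumes "infinite (UNIV :: 'k::field set)"
  shows "\<exists>c :: 'k. c \<noteq> 0 \<and> (\<forall>i\<le>N. \<forall>j\<le>N. c ^ i = c ^ j \<longrightarrow> i = j)"
proof -
  have "finite {c :: 'k. c ^ k = 1}" if "0 < k" for k
  proof -
    have "monom 1 k - 1 \<noteq> (0 :: 'k poly)"
      using that by (metis degree_1 degree_monom_eq eq_iff_diff_eq_0 less_irrefl zero_neq_one)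
    then show ?thesis using poly_roots_finite[of "monom 1 k - 1 :: 'k poly"] by (simp add: poly_monom)
  qed
  then have "finite (insert (0 :: 'k) (\<Union>k\<in>{0<..N}. {c. c ^ k = 1}))" by simp
  then obtain c :: 'k where "c \<notin> insert 0 (\<Union>k\<in>{0<..N}. {c. c ^ k = 1})"
    using assms ex_new_if_finite by blast
  then have c: "c \<noteq> 0" "\<And>k. 0 < k \<Longrightarrow> k \<le> N \<Longrightarrow> c ^ k \<noteq> 1" by auto
  have neq: "c ^ i \<noteq> c ^ j" if "i < j" "j \<le> N" for i j
  proof
    assume "c ^ i = c ^ j"
    also have "\<dots> = c ^ i * c ^ (j - i)" using that by (simp flip: power_add)
    finally have "c ^ (j - i) = 1" using c(1) by simp
    then show False using c(2)[of "j - i"] that by simp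
  qed
  have "i = j" if "i \<le> N" "j \<le> N" "c ^ i = c ^ j" for i j
    using neq[of i j] neq[of j i] that by (metis linorder_neqE_nat)
  then show ?thesis using c(1) by blast
qed

lemma bex_lines:
  "(\<exists>k\<in>lines l. Q k) \<longleftrightarrow> Q (line1 l) \<or> Q line2 \<or> Q (line3 l) \<or> (\<exists>(x, y, z)\<in>triples l. Q {x, y, z})"
  by (simp add: lines_def bex_Un split_beta)

text \<open>Puts incidence with a triple into the six orders that occur in
  \<open>det3_coords_eq_0_iff\<close>.\<close>

lemma bex_triples_superset:
  assumes "a \<noteq> b" "a \<noteq> c" "b \<noteq> c"
  shows "(\<exists>(x, y, z)\<in>T. {a, b, c} \<subseteq> {x, y, z}) \<longleftrightarrow> (a, b, c) \<in> T \<or> (a, c, b) \<in> T \<or>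
    (b, a, c) \<in> T \<or> (b, c, a) \<in> T \<or> (c, a, b) \<in> T \<or> (c, b, a) \<in> T" (is "?L \<longleftrightarrow> ?R")
proof
  assume ?L
  then obtain x y z where t: "(x, y, z) \<in> T" "{a, b, c} \<subseteq> {x, y, z}" by blast
  then have "(x, y, z) \<in> {(a, b, c), (a, c, b), (b, a, c), (b, c, a), (c, a, b), (c, b, a)}"
    using assms by auto
  then show ?R using t(1) by auto
next
  assume ?R
  then show ?L by (elim disjE) (rule bexI, rule case_prodI2, auto)+
qed

lemma place_line_iff:
  assumes "x \<in> ground l"
  shows "place \<gamma> x \<in> {E1, E2} \<union> range L1 \<longleftrightarrow> x \<in> line1 l"
    "place \<gamma> x \<in> {E2, E3} \<union> range L2 \<longleftrightarrow> x \<in> line2"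
    "place \<gamma> x \<in> {E1, E3} \<union> range L3 \<longleftrightarrow> x \<in> line3 l"
  using assms by (cases x; simp add: ground_iff line1_def line2_def line3_def image_iff)+

lemma balanced_place_iff:
  assumes pow: "\<And>i j. i \<le> 7 * n + 10 \<Longrightarrow> j \<le> 7 * n + 10 \<Longrightarrow> c ^ i = c ^ j \<Longrightarrow> i = j"
    and xyz: "x \<in> ground (\<lambda>_. n)" "y \<in> ground (\<lambda>_. n)" "z \<in> ground (\<lambda>_. n)"
  shows "balanced (place (\<lambda>x. c ^ exponent n x) x) (place (\<lambda>x. c ^ exponent n x) y)
    (place (\<lambda>x. c ^ exponent n x) z) \<longleftrightarrow> (x, y, z) \<in> triples (\<lambda>_. n)"
    (is "?L \<longleftrightarrow> ?R")
proof (cases "x \<in> {Node b i | b i. i \<le> n} \<and> y \<in> range Shift \<union> range Link \<and>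
    z \<in> range End \<union> {Mid b i | b i. i < n}")
  case True
  then have "?L \<longleftrightarrow> c ^ exponent n z = c ^ exponent n x * c ^ exponent n y"
    by (auto simp: balanced_def simp del: exponent.simps)
  also have "\<dots> \<longleftrightarrow> exponent n z = exponent n x + exponent n y"
  proof -
    have "exponent n z = exponent n x + exponent n y"
      if "c ^ exponent n z = c ^ (exponent n x + exponent n y)"
    proof (rule pow[OF _ _ that])
      show "exponent n z \<le> 7 * n + 10" using exponent_le[OF xyz(3)] by linarith
      show "exponent n x + exponent n y \<le> 7 * n + 10" using True by auto
    qed
    then have "c ^ exponent n z = c ^ (exponent n x + exponent n y) \<longleftrightarrow>
        exponent n z = exponent n x + exponent n y"
      by metis
    then show ?thesis by (simp only: power_add)
  qed
  also have "\<dots> \<longleftrightarrow> ?R" using triples_exponent_iff True by simp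
  finally show ?thesis .
next
  case False
  have "\<not> ?R"
  proof
    assume ?R
    then show False
      using False xyz by (cases rule: triplesE) (simp_all add: ground_iff)
  qed
  moreover have "\<not> ?L"
  proof
    assume ?L
    then show False
      using False xyz by (cases x; cases y; cases z; simp add: balanced_def ground_iff)
  qed
  ultimately show ?thesis by simp
qed

text \<open>All gains are powers of one element \<open>c\<close>, so the multiplicative condition
  for collinearity becomes the additive one between exponents.\<close>

lemma ladder_representable:
  assumes "infinite (UNIV :: 'k::field set)" "0 < n"
  shows "representable TYPE('k) (ground (\<lambda>_. n)) (ladder_indep (\<lambda>_. n))"
proof -
  obtain c :: 'k where c: "c \<noteq> 0"
    and pow: "\<And>i j. i \<le> 7 * n + 10 \<Longrightarrow> j \<le> 7 * n + 10 \<Longrightarrow> c ^ i = c ^ j \<Longrightarrow> i = j"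
    using infinite_field_distinct_powers[OF assms(1), of "7 * n + 10"] by blast
  define P where "P = place (\<lambda>x. c ^ exponent n x)"
  have nz: "P x \<notin> {L1 0, L2 0, L3 0}" for x
    using c by (cases x) (simp_all add: P_def)
  have inj: "P x \<noteq> P y" if "x \<in> ground (\<lambda>_. n)" "y \<in> ground (\<lambda>_. n)" "x \<noteq> y" for x y
    using place_inj[OF pow assms(2) that(1,2)] that(3) unfolding P_def by blast
  show ?thesis
  proof (rule representable_line_indep)
    show "matroid (ground (\<lambda>_. n)) (ladder_indep (\<lambda>_. n))"
      using assms(2) by (rule matroid_ladder)
    show "ladder_indep (\<lambda>_. n) {J1, J2, J3}" by (rule ladder_indep_joints)
    show "card {J1, J2, J3} = 3" by simp
    fix x y z assume sub: "{x, y, z} \<subseteq> ground (\<lambda>_. n)" and ne: "x \<noteq> y" "x \<noteq> z" "y \<noteq> z"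
    have gr: "x \<in> ground (\<lambda>_. n)" "y \<in> ground (\<lambda>_. n)" "z \<in> ground (\<lambda>_. n)" using sub by auto
    have line: "{P x, P y, P z} \<subseteq> {E1, E2} \<union> range L1 \<longleftrightarrow> {x, y, z} \<subseteq> line1 (\<lambda>_. n)"
      "{P x, P y, P z} \<subseteq> {E2, E3} \<union> range L2 \<longleftrightarrow> {x, y, z} \<subseteq> line2"
      "{P x, P y, P z} \<subseteq> {E1, E3} \<union> range L3 \<longleftrightarrow> {x, y, z} \<subseteq> line3 (\<lambda>_. n)"
      unfolding P_def by (simp_all only: insert_subset empty_subsetI
        place_line_iff[OF gr(1)] place_line_iff[OF gr(2)] place_line_iff[OF gr(3)])
    have bal: "balanced (P u) (P v) (P w) \<longleftrightarrow> (u, v, w) \<in> triples (\<lambda>_. n)"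
      if "u \<in> {x, y, z}" "v \<in> {x, y, z}" "w \<in> {x, y, z}" for u v w
      unfolding P_def by (rule balanced_place_iff[OF pow]) (use that sub in auto)
    have "{P x, P y, P z} \<inter> {L1 0, L2 0, L3 0} = {}" using nz by auto
    from det3_coords_eq_0_iff[OF inj[OF gr(1,2) ne(1)] inj[OF gr(1,3) ne(2)] inj[OF gr(2,3) ne(3)] this]
    show "det3 (coords (P x)) (coords (P y)) (coords (P z)) = 0 \<longleftrightarrow>
      (\<exists>k\<in>lines (\<lambda>_. n). {x, y, z} \<subseteq> k)"
      unfolding bex_lines bex_triples_superset[OF ne] line by (simp add: bal)
  qed
qed

section \<open>Indistinguishable ladders\<close>

definition lengths :: "nat \<Rightarrow> nat \<Rightarrow> bool \<Rightarrow> nat" where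
  "lengths n m b = (if b then n else m)"

definition rail1 :: "nat \<Rightarrow> element set" where
  "rail1 n = {Node True i | i. i \<le> n} \<union> {Mid True i | i. i < n}"

text \<open>All points shared by the rails go to the column side, so that the row index contributes
  only its own rail.\<close>

definition rail2 :: "nat \<Rightarrow> element set" where
  "rail2 m = {J1, J2, J3} \<union> range Shift \<union> range Link \<union> range End \<union>
    {Node False i | i. i \<le> m} \<union> {Mid False i | i. i < m}"

lemma ground_lengths: "ground (lengths n m) = rail1 n \<union> rail2 m"
proof (rule Set.set_eqI)
  show "x \<in> ground (lengths n m) \<longleftrightarrow> x \<in> rail1 n \<union> rail2 m" for x
    by (cases x) (auto simp: ground_iff rail1_def rail2_def lengths_def)
qed

lemma rails_disjoint: "rail1 n \<inter> rail2 m = {}"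
  by (auto simp: rail1_def rail2_def)

lemma bex_triples:
  "(\<exists>(x, y, z)\<in>triples l. Q {x, y, z}) \<longleftrightarrow>
    (\<exists>b\<in>UNIV. \<exists>s\<in>UNIV. \<exists>i<l b. Q {Node b (i + of_bool s), Shift s, Mid b i}) \<or>
    (\<exists>b\<in>UNIV. \<exists>t\<in>UNIV. Q {Node b (if t then l b else 0), Link b, End t})"
    (is "?L \<longleftrightarrow> ?R")
proof
  assume ?L
  then obtain x y z where t: "(x, y, z) \<in> triples l" "Q {x, y, z}" by auto
  from t(1) show ?R
  proof (cases rule: triplesE)
    case (shift b i s)
    then show ?thesis using t(2) by (intro disjI1 bexI[of _ b] bexI[of _ s] exI[of _ i]) simp_all
  next
    case (link b t)
    then show ?thesis using \<open>Q {x, y, z}\<close> by (intro disjI2 bexI[of _ b] bexI[of _ t]) simp_all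
  qed
next
  assume ?R
  then show ?L
  proof (elim disjE bexE exE conjE)
    fix b s i assume "i < l b" "Q {Node b (i + of_bool s), Shift s, Mid b i}"
    then show ?L by (intro bexI[OF _ shift_triple[of i l b s]]) simp_all
  next
    fix b t assume "Q {Node b (if t then l b else 0), Link b, End t}"
    then show ?L by (intro bexI[OF _ link_triple[of b t l]]) simp_all
  qed
qed

lemma finite_rows_product:
  assumes "\<And>a b. a \<in> A \<Longrightarrow> b \<in> B \<Longrightarrow> f a b \<longleftrightarrow> P a \<and> Q b"
  shows "finite_rows A B f"
proof -
  have "finite_rows A B (\<lambda>a b. P a \<and> Q b)"
    by (intro finite_rows_conj finite_rows_left finite_rows_right)
  also have "?this \<longleftrightarrow> ?thesis" by (rule finite_rows_cong) (use assms in simp)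
  finally show ?thesis .
qed

text \<open>Lying on a given line splits into a condition on each part. The only unbounded choice,
  the position \<open>i\<close> in a shift triple, concerns a single rail and can be absorbed into
  the condition on that side; the other choices range over finite types.\<close>

lemma finite_rows_collinear:
  fixes I J :: "nat set"
  defines "A \<equiv> SIGMA n:I. Pow (rail1 n)" and "B \<equiv> SIGMA m:J. Pow (rail2 m)"
  shows "finite_rows A B (\<lambda>a b. \<exists>k\<in>lines (lengths (fst a) (fst b)). snd a \<union> snd b \<subseteq> k)"
proof -
  have A: "snd a \<subseteq> rail1 (fst a)" if "a \<in> A" for a using that by (auto simp: A_def)
  have B: "snd b \<subseteq> rail2 (fst b)" if "b \<in> B" for b using that by (auto simp: B_def)
  \<comment> \<open>Only the traces of the line on the two parts count, and each trace must depend
    on its own index alone.\<close>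
  have meet: "finite_rows A B (\<lambda>a b. snd a \<union> snd b \<subseteq> K a b)"
    if "\<And>a b. K a b \<inter> rail1 (fst a) = KA a \<inter> rail1 (fst a)" "\<And>a b. K a b \<inter> rail2 (fst b) = KB b \<inter> rail2 (fst b)" for K KA KB
    by (rule finite_rows_product[where P = "\<lambda>a. snd a \<subseteq> KA a" and Q = "\<lambda>b. snd b \<subseteq> KB b"])
      (use that A B in blast)
  have 1: "finite_rows A B (\<lambda>a b. snd a \<union> snd b \<subseteq> line1 (lengths (fst a) (fst b)))"
    by (rule meet[where KA = "\<lambda>_. range (Node True)" and KB = "\<lambda>_. {J1, J2} \<union> range (Node False)"])
      (auto simp: line1_def lengths_def rail1_def rail2_def)
  have 2: "finite_rows A B (\<lambda>a b. snd a \<union> snd b \<subseteq> line2)"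
    by (rule meet) simp_all
  have 3: "finite_rows A B (\<lambda>a b. snd a \<union> snd b \<subseteq> line3 (lengths (fst a) (fst b)))"
    by (rule meet[where KA = "\<lambda>_. range (Mid True)" and KB = "\<lambda>_. {J1, J3} \<union> range End \<union> range (Mid False)"])
      (auto simp: line3_def lengths_def rail1_def rail2_def)
  have 4: "finite_rows A B (\<lambda>a b. \<exists>i<lengths (fst a) (fst b) c.
      snd a \<union> snd b \<subseteq> {Node c (i + of_bool s), Shift s, Mid c i})" for c s
  proof (cases c)
    case True
    have "finite_rows A B (\<lambda>a b. \<exists>i<fst a.
        snd a \<union> snd b \<subseteq> {Node True (i + of_bool s), Shift s, Mid True i})"
    proof (rule finite_rows_product)
      fix a b assume ab: "a \<in> A" "b \<in> B"
      have "snd a \<union> snd b \<subseteq> {Node True (i + of_bool s), Shift s, Mid True i} \<longleftrightarrow>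
        snd a \<subseteq> {Node True (i + of_bool s), Mid True i} \<and> snd b \<subseteq> {Shift s}" for i
      proof -
        have "Shift s \<notin> snd a" using A[OF ab(1)] by (auto simp: rail1_def)
        moreover have "Node True (i + of_bool s) \<notin> snd b" "Mid True i \<notin> snd b"
          using B[OF ab(2)] by (auto simp: rail2_def)
        ultimately show ?thesis by blast
      qed
      then show "(\<exists>i<fst a. snd a \<union> snd b \<subseteq> {Node True (i + of_bool s), Shift s, Mid True i}) \<longleftrightarrow>
        (\<exists>i<fst a. snd a \<subseteq> {Node True (i + of_bool s), Mid True i}) \<and> snd b \<subseteq> {Shift s}"
        by (simp only:) blast
    qed
    then show ?thesis using True by (simp add: lengths_def)
  next
    case False
    have "finite_rows A B (\<lambda>a b. \<exists>i<fst b.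
        snd a \<union> snd b \<subseteq> {Node False (i + of_bool s), Shift s, Mid False i})"
    proof (rule finite_rows_product)
      fix a b assume ab: "a \<in> A" "b \<in> B"
      have "snd a \<union> snd b \<subseteq> {Node False (i + of_bool s), Shift s, Mid False i} \<longleftrightarrow>
        snd a = {} \<and> snd b \<subseteq> {Node False (i + of_bool s), Shift s, Mid False i}" for i
      proof -
        have "rail1 (fst a) \<inter> {Node False (i + of_bool s), Shift s, Mid False i} = {}"
          by (auto simp: rail1_def)
        then have "snd a \<inter> {Node False (i + of_bool s), Shift s, Mid False i} = {}"
          using A[OF ab(1)] by blast
        then show ?thesis by auto
      qed
      then show "(\<exists>i<fst b. snd a \<union> snd b \<subseteq> {Node False (i + of_bool s), Shift s, Mid False i}) \<longleftrightarrow>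
        snd a = {} \<and> (\<exists>i<fst b. snd b \<subseteq> {Node False (i + of_bool s), Shift s, Mid False i})"
        by (simp only:) blast
    qed
    then show ?thesis using False by (simp add: lengths_def)
  qed
  have 5: "finite_rows A B (\<lambda>a b. snd a \<union> snd b \<subseteq>
      {Node c (if t then lengths (fst a) (fst b) c else 0), Link c, End t})" for c t
    \<comment> \<open>Both sets name the last node of rail \<open>c\<close> by their own index. On
      the side that does not contain this rail, the node lies outside the trace and does no
      harm.\<close>
    by (rule meet[where KA = "\<lambda>a. {Node c (if t then fst a else 0)}" and KB = "\<lambda>b. {Node c (if t then fst b else 0), Link c, End t}"])
      (cases c; auto simp: lengths_def rail1_def rail2_def)+
  show ?thesis
    unfolding bex_lines bex_triples
    by (intro finite_rows_disj finite_rows_Bex 1 2 3 4 5 finite)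
qed

text \<open>Only cardinalities up to three matter, and each of them splits additively over the
  disjoint rails.\<close>

lemma finite_rows_ladder_indep:
  "finite_rows (SIGMA n:I. Pow (rail1 n)) (SIGMA m:J. Pow (rail2 m))
    (\<lambda>a b. ladder_indep (lengths (fst a) (fst b)) (snd a \<union> snd b))"
proof -
  let ?A = "SIGMA n:I. Pow (rail1 n)" and ?B = "SIGMA m:J. Pow (rail2 m)"
  let ?card = "\<lambda>k a b. card (snd a \<union> snd b) = k"
  have card: "finite_rows ?A ?B (?card k)" for k
  proof (rule finite_rows_card_eq)
    fix a b assume a: "a \<in> ?A" and b: "b \<in> ?B"
    then have "snd a \<subseteq> ground (lengths (fst a) (fst b))" "snd b \<subseteq> ground (lengths (fst a) (fst b))"
      by (auto simp: ground_lengths)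
    moreover have "snd a \<inter> snd b = {}"
    proof -
      have "snd a \<subseteq> rail1 (fst a)" "snd b \<subseteq> rail2 (fst b)" using a b by auto
      then show ?thesis using rails_disjoint[of "fst a" "fst b"] by blast
    qed
    ultimately show "card (snd a \<union> snd b) = card (snd a) + card (snd b)"
      by (intro card_Un_disjoint) (auto intro: finite_subset[OF _ finite_ground])
  qed
  have "finite_rows ?A ?B (\<lambda>a b. (\<exists>k\<in>{..3}. ?card k a b) \<and>
      \<not> (?card 3 a b \<and> (\<exists>k\<in>lines (lengths (fst a) (fst b)). snd a \<union> snd b \<subseteq> k)))"
    by (intro finite_rows_conj finite_rows_Not finite_rows_Bex card finite_rows_collinear finite_atMost)
  also have "?this \<longleftrightarrow> ?thesis"
    by (rule finite_rows_cong) (auto simp: line_indep_def ground_lengths)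
  finally show ?thesis .
qed

lemma exists_same_truth_value:
  fixes \<psi> :: ms0
  obtains n m where "n \<noteq> m" "0 < n" "0 < m"
    "sat (ground (lengths n n)) (ladder_indep (lengths n n)) (\<lambda>_. {}) \<psi> \<longleftrightarrow>
     sat (ground (lengths m n)) (ladder_indep (lengths m n)) (\<lambda>_. {}) \<psi>"
proof -
  let ?P = "assignments {0<..} rail1" and ?Q = "assignments {0<..} rail2"
  let ?f = "\<lambda>a b. sat (rail1 (fst a) \<union> rail2 (fst b)) (ladder_indep (lengths (fst a) (fst b))) (\<lambda>i. snd a i \<union> snd b i) \<psi>"
  let ?row = "\<lambda>a. {b \<in> ?Q. ?f a b}"
  have fin: "finite (rail1 n)" "finite (rail2 n)" for n
    using finite_ground[of "lengths n n"] by (simp_all add: ground_lengths)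
  have "finite_rows ?P ?Q ?f"
    by (rule finite_rows_sat) (use fin rails_disjoint finite_rows_ladder_indep in auto)
  then have "finite (?row ` ?P)" by (simp add: finite_rows_def)
  moreover define r where "r n = ?row (n, \<lambda>_. {})" for n
  have "r ` {0<..} \<subseteq> ?row ` ?P"
    unfolding r_def by (rule image_subsetI, rule imageI) (simp add: assignments_def)
  ultimately have "finite (r ` {0<..})" by (rule rev_finite_subset)
  then have "\<not> inj_on r {0<..}"
    using finite_imageD infinite_Ioi by blast
  then obtain n m where nm: "0 < n" "0 < m" "n \<noteq> m" and eq: "r n = r m"
    unfolding inj_on_def by auto
  \<comment> \<open>Column \<open>n\<close> is the one to compare in: there row \<open>n\<close> has
    rails of equal length and row \<open>m\<close> does not.\<close>
  have "(n, \<lambda>_. {}) \<in> ?Q" using nm by (simp add: assignments_def)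
  then have "?f (n, \<lambda>_. {}) (n, \<lambda>_. {}) \<longleftrightarrow> ?f (m, \<lambda>_. {}) (n, \<lambda>_. {})"
    using eq unfolding r_def set_eq_iff mem_Collect_eq by blast
  then show thesis using that nm by (simp add: ground_lengths)
qed

theorem theorem1p2:
  assumes "infinite (UNIV :: 'k::field set)"
  shows "\<not> (\<exists>\<psi>. sentence \<psi> \<and>
    (\<forall>(E :: nat set) indep. matroid E indep \<longrightarrow>
      (representable TYPE('k) E indep \<longleftrightarrow> satisfies E indep \<psi>)))"
proof
  assume "\<exists>\<psi>. sentence \<psi> \<and>
    (\<forall>(E :: nat set) indep. matroid E indep \<longrightarrow>
      (representable TYPE('k) E indep \<longleftrightarrow> satisfies E indep \<psi>))"
  then obtain \<psi> where \<psi>: "sentence \<psi>"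
    and char: "\<And>(E :: nat set) indep. matroid E indep \<Longrightarrow>
      representable TYPE('k) E indep \<longleftrightarrow> satisfies E indep \<psi>" by blast
  have inj: "inj (to_nat :: element \<Rightarrow> nat)" by simp
  have ladder: "representable TYPE('k) (ground l) (ladder_indep l) \<longleftrightarrow>
      sat (ground l) (ladder_indep l) (\<lambda>_. {}) \<psi>" if "\<And>b. 0 < l b" for l
    using char[OF matroid_image[OF inj matroid_ladder[of l, OF that]]]
    unfolding representable_image[OF inj] satisfies_image[OF inj \<psi>]
    by (simp only: satisfies_sentence_iff[OF \<psi>])
  obtain n m where nm: "n \<noteq> m" "0 < n" "0 < m" and same:
    "sat (ground (lengths n n)) (ladder_indep (lengths n n)) (\<lambda>_. {}) \<psi> \<longleftrightarrow>
     sat (ground (lengths m n)) (ladder_indep (lengths m n)) (\<lambda>_. {}) \<psi>"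
    by (rule exists_same_truth_value)
  have pos: "0 < lengths n n b" "0 < lengths m n b" for b using nm by (simp_all add: lengths_def)
  have "lengths n n = (\<lambda>_. n)" by (rule ext) (simp add: lengths_def)
  then have "representable TYPE('k) (ground (lengths n n)) (ladder_indep (lengths n n))"
    using ladder_representable[OF assms nm(2)] by simp
  then have "representable TYPE('k) (ground (lengths m n)) (ladder_indep (lengths m n))"
    using ladder[OF pos(1)] ladder[OF pos(2)] same by simp
  then have "lengths m n True = lengths m n False"
    by (rule ladder_representable_imp)
  then show False using nm(1) by (simp add: lengths_def)
qed

end
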